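(* Let $(g,f)$ be a homogeneous pair of degree $\alpha\in\mathbb{R}-\{0\}$ on a manifold $M$ with a free $\mathbb{R}_{>0}$-action. Let $l>0$, $M_l=f^{-1}(l)$, let $g_l$ be the pullback of $g$ to $M_l$, and let $\beta\in\mathbb{R}$. (1) The function $f$ is geodesically convex with respect to $f^\beta g$ if one of the following conditions holds: - $\beta=-1$; - $-1<\beta\le1$ and $\alpha g_l$ is positive definite; - $\beta<-1$ and $\alpha g_l$ is negative definite. (2) The function $f$ is geodesically concave with respect to $f^\beta g$ if $\beta\ge1$ and $\alpha g_l$ is negative definite.
   Context: A function $f$ is geodesically convex (resp. concave) with respect to a pseudo-Riemannian metric $h$ if $t\mapsto f(\gamma(t))$ is convex (resp. concave) for every geodesic $\gamma$ of $h$. Homogeneous pair: $m:\mathbb{R}_{>0}\times M\to M$ is a smooth free action, $m_\lambda=m(\lambda,\cdot)$, $P_x=\frac{d}{dt}m(e^t,x)|_{t=0}$. For a pseudo-Riemannian metric $g$, a smooth $f:M\to\mathbb{R}_{>0}$ and $\alpha\in\mathbb{R}-\{0\}$, $(g,f)$ is a homogeneous pair of degree $\alpha$ if $m_\lambda^*g=\lambda^\alpha g$, $m_\lambda^*f=\lambda^\alpha f$ for all $\lambda>0$ and $g(P,\cdot)=df$. *)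

theory Defs
  imports "HOL-Analysis.Analysis"
begin

section \<open>Smooth maps between open subsets of Euclidean spaces\<close>

primrec k_smooth_on ::
  "nat \<Rightarrow> 'a::euclidean_space set \<Rightarrow> ('a \<Rightarrow> 'b::real_normed_vector) \<Rightarrow> bool"
where
  "k_smooth_on 0 S f \<longleftrightarrow> continuous_on S f"
| "k_smooth_on (Suc k) S f \<longleftrightarrow> (\<forall>x\<in>S. f differentiable (at x)) \<and>
     (\<forall>v. k_smooth_on k S (\<lambda>x. frechet_derivative f (at x) v))"

text \<open>Class \<open>C\<^sup>\<infinity>\<close>; meaningful for open \<open>S\<close>, the only case in which it is used.\<close>
definition smooth_on ::
  "'a::euclidean_space set \<Rightarrow> ('a \<Rightarrow> 'b::real_normed_vector) \<Rightarrow> bool"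
  where "smooth_on S f \<longleftrightarrow> (\<forall>k. k_smooth_on k S f)"

section \<open>Smooth manifolds\<close>

text \<open>
  A manifold is given by a topology \<open>X\<close> and a smooth atlas \<open>A\<close> on it. A chart is a pair
  \<open>(U, \<phi>)\<close> of an open domain and a coordinate map into the Euclidean space \<open>'e\<close>; its inverse is
  \<open>inv_into U \<phi>\<close>. The atlas need not be maximal. Values of functions outside
  \<open>topspace X\<close> are irrelevant throughout.
\<close>

type_synonym ('m, 'e) chart = "'m set \<times> ('m \<Rightarrow> 'e)"

definition smooth_manifold :: "'m topology \<Rightarrow> ('m, 'e::euclidean_space) chart set \<Rightarrow> bool" where
  "smooth_manifold X A \<longleftrightarrow>
     Hausdorff_space X \<and>
     (\<exists>B. countable B \<and> (\<forall>V\<in>B. openin X V) \<and>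
          (\<forall>U x. openin X U \<and> x \<in> U \<longrightarrow> (\<exists>V\<in>B. x \<in> V \<and> V \<subseteq> U))) \<and>
     (\<Union>(U, \<phi>)\<in>A. U) = topspace X \<and>
     (\<forall>(U, \<phi>)\<in>A. openin X U \<and> open (\<phi> ` U) \<and>
        homeomorphic_map (subtopology X U) (top_of_set (\<phi> ` U)) \<phi>) \<and>
     (\<forall>(U, \<phi>)\<in>A. \<forall>(V, \<psi>)\<in>A. smooth_on (\<phi> ` (U \<inter> V)) (\<lambda>x. \<psi> (inv_into U \<phi> x)))"

definition smooth_function ::
  "('m, 'e::euclidean_space) chart set \<Rightarrow> ('m \<Rightarrow> real) \<Rightarrow> bool" where
  "smooth_function A u \<longleftrightarrow> (\<forall>(U, \<phi>)\<in>A. smooth_on (\<phi> ` U) (\<lambda>x. u (inv_into U \<phi> x)))"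

definition smooth_near ::
  "('m, 'e::euclidean_space) chart set \<Rightarrow> 'm \<Rightarrow> ('m \<Rightarrow> real) \<Rightarrow> bool" where
  "smooth_near A p u \<longleftrightarrow> (\<exists>(U, \<phi>)\<in>A. p \<in> U \<and>
     (\<exists>V. open V \<and> \<phi> p \<in> V \<and> V \<subseteq> \<phi> ` U \<and> smooth_on V (\<lambda>x. u (inv_into U \<phi> x))))"

definition smooth_curve ::
  "'m topology \<Rightarrow> ('m, 'e::euclidean_space) chart set \<Rightarrow> real set \<Rightarrow> (real \<Rightarrow> 'm) \<Rightarrow> bool" where
  "smooth_curve X A I \<gamma> \<longleftrightarrow>
     continuous_map (top_of_set I) X \<gamma> \<and>
     (\<forall>(U, \<phi>)\<in>A. smooth_on {t \<in> I. \<gamma> t \<in> U} (\<lambda>t. \<phi> (\<gamma> t)))"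

section \<open>Tangent vectors\<close>

text \<open>
  A tangent vector at \<open>p\<close> is the velocity of a smooth curve through \<open>p\<close>, where the velocity is the
  operator that differentiates, along the curve, the functions smooth near \<open>p\<close>. The clause \<open>0\<close> for all other
  functions makes equality of tangent vectors the right one. The vector space operations on
  tangent vectors are pointwise, and the zero vector is \<open>\<lambda>_. 0\<close>. For a function \<open>u\<close> and a
  tangent vector \<open>V\<close> at \<open>p\<close>, the value \<open>V u\<close> is \<open>du(V)\<close>.
\<close>

type_synonym 'm tangent = "('m \<Rightarrow> real) \<Rightarrow> real"

definition velocity ::
  "('m, 'e::euclidean_space) chart set \<Rightarrow> (real \<Rightarrow> 'm) \<Rightarrow> real \<Rightarrow> 'm tangent" where
  "velocity A \<gamma> t = (\<lambda>u. if smooth_near A (\<gamma> t) u then deriv (\<lambda>s. u (\<gamma> s)) t else 0)"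

text \<open>
  For an embedded submanifold \<open>S\<close>, the image of \<open>T\<^sub>pS\<close> in \<open>T\<^sub>pM\<close> under the differential of the
  inclusion: the velocities of the curves that stay in \<open>S\<close>.
\<close>
definition tangent_space_of ::
  "'m topology \<Rightarrow> ('m, 'e::euclidean_space) chart set \<Rightarrow> 'm set \<Rightarrow> 'm \<Rightarrow> 'm tangent set" where
  "tangent_space_of X A S p = {velocity A \<gamma> 0 | \<gamma>. \<gamma> 0 = p \<and>
     (\<exists>e>0. smooth_curve X A {-e<..<e} \<gamma> \<and> \<gamma> ` {-e<..<e} \<subseteq> S)}"

abbreviation tangent_space ::
  "'m topology \<Rightarrow> ('m, 'e::euclidean_space) chart set \<Rightarrow> 'm \<Rightarrow> 'm tangent set" where
  "tangent_space X A p \<equiv> tangent_space_of X A (topspace X) p"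

definition pushforward ::
  "('m, 'e::euclidean_space) chart set \<Rightarrow> ('m \<Rightarrow> 'm) \<Rightarrow> 'm \<Rightarrow> 'm tangent \<Rightarrow> 'm tangent" where
  "pushforward A F p V = (\<lambda>u. if smooth_near A (F p) u then V (\<lambda>q. u (F q)) else 0)"

text \<open>The vector at \<open>p\<close> whose coordinates in the chart \<open>(U, \<phi>)\<close> are \<open>v\<close>.\<close>
definition coordinate_vector ::
  "('m, 'e::euclidean_space) chart set \<Rightarrow> ('m, 'e) chart \<Rightarrow> 'm \<Rightarrow> 'e \<Rightarrow> 'm tangent" where
  "coordinate_vector A = (\<lambda>(U, \<phi>) p v u. if smooth_near A p u
     then frechet_derivative (\<lambda>x. u (inv_into U \<phi> x)) (at (\<phi> p)) v else 0)"

section \<open>Pseudo-Riemannian metrics and geodesics\<close>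

type_synonym 'm metric_tensor = "'m \<Rightarrow> 'm tangent \<Rightarrow> 'm tangent \<Rightarrow> real"

definition local_metric ::
  "('m, 'e::euclidean_space) chart set \<Rightarrow> 'm metric_tensor \<Rightarrow> ('m, 'e) chart \<Rightarrow>
   'e \<Rightarrow> 'e \<Rightarrow> 'e \<Rightarrow> real" where
  "local_metric A g = (\<lambda>(U, \<phi>) x v w. let p = inv_into U \<phi> x in
     g p (coordinate_vector A (U, \<phi>) p v) (coordinate_vector A (U, \<phi>) p w))"

text \<open>
  The signature is locally constant by continuity; it may differ between connected components.
\<close>
definition pseudo_riemannian_metric ::
  "'m topology \<Rightarrow> ('m, 'e::euclidean_space) chart set \<Rightarrow> 'm metric_tensor \<Rightarrow> bool" where
  "pseudo_riemannian_metric X A g \<longleftrightarrow>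
     (\<forall>p\<in>topspace X. let T = tangent_space X A p in
        (\<forall>V\<in>T. \<forall>W\<in>T. g p V W = g p W V) \<and>
        (\<forall>V\<in>T. \<forall>V'\<in>T. \<forall>W\<in>T. \<forall>a b.
           g p (\<lambda>u. a * V u + b * V' u) W = a * g p V W + b * g p V' W) \<and>
        (\<forall>V\<in>T. (\<forall>W\<in>T. g p V W = 0) \<longrightarrow> V = (\<lambda>_. 0))) \<and>
     (\<forall>(U, \<phi>)\<in>A. \<forall>v w. smooth_on (\<phi> ` U) (\<lambda>x. local_metric A g (U, \<phi>) x v w))"

text \<open>
  Christoffel symbols \<open>\<Gamma>(v, w) = \<Gamma>\<^sup>k\<^sub>i\<^sub>j v\<^sup>i w\<^sup>j \<partial>\<^sub>k\<close> of the Levi-Civita connection: the index is raised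
  by nondegeneracy of \<open>G\<close>, i.e. \<open>\<Gamma>(v, w)\<close> is the vector whose \<open>G\<close>-product with \<open>u\<close> is
  \<open>\<onehalf> (\<partial>\<^sub>v G(w, u) + \<partial>\<^sub>w G(v, u) - \<partial>\<^sub>u G(v, w))\<close>.
\<close>
definition christoffel ::
  "('e::euclidean_space \<Rightarrow> 'e \<Rightarrow> 'e \<Rightarrow> real) \<Rightarrow> 'e \<Rightarrow> 'e \<Rightarrow> 'e \<Rightarrow> 'e" where
  "christoffel G x v w = (THE z. \<forall>u. G x z u =
     (frechet_derivative (\<lambda>y. G y w u) (at x) v
      + frechet_derivative (\<lambda>y. G y v u) (at x) w
      - frechet_derivative (\<lambda>y. G y v w) (at x) u) / 2)"

definition geodesic ::
  "'m topology \<Rightarrow> ('m, 'e::euclidean_space) chart set \<Rightarrow> 'm metric_tensor \<Rightarrow>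
   real set \<Rightarrow> (real \<Rightarrow> 'm) \<Rightarrow> bool" where
  "geodesic X A h I \<gamma> \<longleftrightarrow> open I \<and> is_interval I \<and> smooth_curve X A I \<gamma> \<and>
     (\<forall>(U, \<phi>)\<in>A. \<forall>t\<in>I. \<gamma> t \<in> U \<longrightarrow>
        (let c = (\<lambda>s. \<phi> (\<gamma> s)); c' = (\<lambda>s. vector_derivative c (at s)) in
           vector_derivative c' (at t)
           + christoffel (local_metric A h (U, \<phi>)) (c t) (c' t) (c' t) = 0))"

definition geodesically_convex ::
  "'m topology \<Rightarrow> ('m, 'e::euclidean_space) chart set \<Rightarrow> 'm metric_tensor \<Rightarrow> ('m \<Rightarrow> real) \<Rightarrow> bool"
where
  "geodesically_convex X A h f \<longleftrightarrow> (\<forall>I \<gamma>. geodesic X A h I \<gamma> \<longrightarrow> convex_on I (\<lambda>t. f (\<gamma> t)))"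

definition geodesically_concave ::
  "'m topology \<Rightarrow> ('m, 'e::euclidean_space) chart set \<Rightarrow> 'm metric_tensor \<Rightarrow> ('m \<Rightarrow> real) \<Rightarrow> bool"
where
  "geodesically_concave X A h f \<longleftrightarrow> (\<forall>I \<gamma>. geodesic X A h I \<gamma> \<longrightarrow> concave_on I (\<lambda>t. f (\<gamma> t)))"

definition scale_tensor :: "('m \<Rightarrow> real) \<Rightarrow> 'm metric_tensor \<Rightarrow> 'm metric_tensor" where
  "scale_tensor s g = (\<lambda>p V W. s p * g p V W)"

definition pullback ::
  "('m, 'e::euclidean_space) chart set \<Rightarrow> ('m \<Rightarrow> 'm) \<Rightarrow> 'm metric_tensor \<Rightarrow> 'm metric_tensor" where
  "pullback A F g = (\<lambda>p V W. g (F p) (pushforward A F p V) (pushforward A F p W))"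

text \<open>
  Definiteness of the pullback of \<open>h\<close> to an embedded submanifold \<open>S\<close>. With \<open>T\<^sub>pS\<close> regarded as a
  subspace of \<open>T\<^sub>pM\<close>, this pullback is the restriction of \<open>h\<close> to \<open>T\<^sub>pS\<close>.
\<close>
definition pullback_positive_definite ::
  "'m topology \<Rightarrow> ('m, 'e::euclidean_space) chart set \<Rightarrow> 'm set \<Rightarrow> 'm metric_tensor \<Rightarrow> bool" where
  "pullback_positive_definite X A S h \<longleftrightarrow>
     (\<forall>p\<in>S. \<forall>V\<in>tangent_space_of X A S p. V \<noteq> (\<lambda>_. 0) \<longrightarrow> h p V V > 0)"

definition pullback_negative_definite ::
  "'m topology \<Rightarrow> ('m, 'e::euclidean_space) chart set \<Rightarrow> 'm set \<Rightarrow> 'm metric_tensor \<Rightarrow> bool" where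
  "pullback_negative_definite X A S h \<longleftrightarrow>
     (\<forall>p\<in>S. \<forall>V\<in>tangent_space_of X A S p. V \<noteq> (\<lambda>_. 0) \<longrightarrow> h p V V < 0)"

section \<open>Homogeneous pairs\<close>

definition smooth_free_action ::
  "'m topology \<Rightarrow> ('m, 'e::euclidean_space) chart set \<Rightarrow> (real \<Rightarrow> 'm \<Rightarrow> 'm) \<Rightarrow> bool" where
  "smooth_free_action X A m \<longleftrightarrow>
     continuous_map (prod_topology (top_of_set {0<..}) X) X (\<lambda>(r, x). m r x) \<and>
     (\<forall>(U, \<phi>)\<in>A. \<forall>(V, \<psi>)\<in>A.
        smooth_on {(r, y). 0 < r \<and> y \<in> \<phi> ` U \<and> m r (inv_into U \<phi> y) \<in> V}
          (\<lambda>(r, y). \<psi> (m r (inv_into U \<phi> y)))) \<and>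
     (\<forall>x\<in>topspace X. m 1 x = x) \<and>
     (\<forall>x\<in>topspace X. \<forall>r>0. \<forall>s>0. m (r * s) x = m r (m s x)) \<and>
     (\<forall>x\<in>topspace X. \<forall>r>0. m r x = x \<longrightarrow> r = 1)"

definition homogeneous_pair ::
  "'m topology \<Rightarrow> ('m, 'e::euclidean_space) chart set \<Rightarrow> (real \<Rightarrow> 'm \<Rightarrow> 'm) \<Rightarrow> real \<Rightarrow>
   'm metric_tensor \<Rightarrow> ('m \<Rightarrow> real) \<Rightarrow> bool" where
  "homogeneous_pair X A m \<alpha> g f \<longleftrightarrow>
     pseudo_riemannian_metric X A g \<and>
     smooth_function A f \<and> (\<forall>x\<in>topspace X. f x > 0) \<and>
     (\<forall>r>0. \<forall>x\<in>topspace X. \<forall>V\<in>tangent_space X A x. \<forall>W\<in>tangent_space X A x.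
        pullback A (m r) g x V W = r powr \<alpha> * g x V W) \<and>
     (\<forall>r>0. \<forall>x\<in>topspace X. f (m r x) = r powr \<alpha> * f x) \<and>
     (\<forall>x\<in>topspace X. \<forall>V\<in>tangent_space X A x.
        g x (velocity A (\<lambda>t. m (exp t) x) 0) V = V f)"

end

theory Submission
  imports Defs
begin

text \<open>
  Let \<open>P\<close> be the vector field that generates the action. Homogeneity says that the Lie derivative of
  \<open>g\<close> along \<open>P\<close> is \<open>\<alpha> g\<close> and that \<open>df(P) = \<alpha> f\<close>. Since \<open>P\<close> is also the gradient of \<open>f\<close>, the Hessian of
  \<open>f\<close> with respect to \<open>g\<close> is \<open>(\<alpha>/2) g\<close>. Passing to the conformal metric \<open>f\<^sup>\<beta> g\<close> adds
  \<open>(\<alpha> \<beta>/2) g - (\<beta>/f) df\<^sup>2\<close> to it, so along a geodesic \<open>\<gamma>\<close> of \<open>f\<^sup>\<beta> g\<close> the function \<open>u = f \<circ> \<gamma>\<close> satisfies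
  \<open>u'' = (\<alpha>/2) (1 + \<beta>) g(\<gamma>', \<gamma>') - \<beta> u'\<^sup>2 / u\<close>.

  Write \<open>\<gamma>' = w + b P\<close> with \<open>w\<close> tangent to the level set of \<open>f\<close>. Then \<open>w\<close> and \<open>P\<close> are orthogonal,
  \<open>g(P, P) = \<alpha> f\<close> and \<open>b = u' / (\<alpha> u)\<close>, so \<open>g(\<gamma>', \<gamma>') = g(w, w) + u'\<^sup>2 / (\<alpha> u)\<close> and
  \<open>u'' = ((1 + \<beta>) / 2) \<alpha> g(w, w) + ((1 - \<beta>) / 2) u'\<^sup>2 / u\<close>.
  Under each of the conditions of the theorem both summands are nonnegative, respectively
  nonpositive. Definiteness is supposed on the single level set \<open>f = l\<close>; the action moves every other
  level set onto this one and multiplies \<open>g\<close> by a positive constant.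

  The formula for \<open>u''\<close> (\<open>second_derivative_along_conformal_geodesic\<close>) is derived in a chart and
  without covariant derivatives. All that enters is the map \<open>(r, s) \<mapsto> m\<^sub>r(\<gamma>(s))\<close>: its \<open>r\<close>-derivative at
  \<open>r = 1\<close> is \<open>P\<close> along \<open>\<gamma>\<close>, its \<open>s\<close>-derivative is the velocity of the translated curve, and the symmetry
  of its second derivative lets the homogeneity of \<open>g\<close>, differentiated in \<open>r\<close>, meet the derivative of
  \<open>u' = g(P, \<gamma>')\<close> in \<open>s\<close>. The vector \<open>w\<close> is obtained as a velocity
  (\<open>level_set_tangent_vector_at_0\<close>): sliding the points of \<open>\<gamma>\<close> along their orbits until \<open>f\<close> is constant
  removes exactly the component along \<open>P\<close>. What connects these computations with tangent vectors as
  differential operators is that they are the coordinate vectors of a chart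
  (\<open>tangent_space_eq_coordinate_vectors\<close>).
\<close>

section \<open>Calculus of smooth maps\<close>

lemma k_smooth_on_cong:
  assumes "open S" and "\<And>x. x \<in> S \<Longrightarrow> f x = g x" and "k_smooth_on k S f"
  shows "k_smooth_on k S g"
  using assms(2,3)
proof (induction k arbitrary: f g)
  case 0
  then show ?case using continuous_on_cong by force
next
  case (Suc k)
  have diff: "f differentiable (at x)" if "x \<in> S" for x
    using Suc.prems that by simp
  have eq: "frechet_derivative f (at x) = frechet_derivative g (at x)" if "x \<in> S" for x
    using frechet_derivative_transform_within_open[OF diff[OF that] \<open>open S\<close> that] Suc.prems(1) by simp
  have "g differentiable (at x)" if "x \<in> S" for x
    using diff[OF that] Suc.prems(1) \<open>open S\<close> that
    by (meson differentiable_def has_derivative_transform_within_open)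
  moreover have "k_smooth_on k S (\<lambda>x. frechet_derivative g (at x) v)" for v
    by (rule Suc.IH[of "\<lambda>x. frechet_derivative f (at x) v"]) (use eq Suc.prems in auto)
  ultimately show ?case by simp
qed

text \<open>
  On an open set the derivative may be given by any explicit formula; the choice made by
  \<open>frechet_derivative\<close> then agrees with it. This is how the derivative rules become rules for
  \<open>k_smooth_on\<close> below.
\<close>
lemma k_smooth_on_SucI:
  assumes "open S" and "\<And>x. x \<in> S \<Longrightarrow> (f has_derivative f' x) (at x)"
    and "\<And>v. k_smooth_on k S (\<lambda>x. f' x v)"
  shows "k_smooth_on (Suc k) S f"
proof -
  have "frechet_derivative f (at x) = f' x" if "x \<in> S" for x
    using frechet_derivative_at[OF assms(2)[OF that]] by simp
  then have "k_smooth_on k S (\<lambda>x. frechet_derivative f (at x) v)" for v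
    using k_smooth_on_cong[OF \<open>open S\<close> _ assms(3)[of v]] by simp
  moreover have "f differentiable (at x)" if "x \<in> S" for x
    using assms(2)[OF that] unfolding differentiable_def by blast
  ultimately show ?thesis by simp
qed

lemma k_smooth_on_SucD:
  assumes "k_smooth_on (Suc k) S f"
  shows "x \<in> S \<Longrightarrow> (f has_derivative frechet_derivative f (at x)) (at x)"
    and "k_smooth_on k S (\<lambda>x. frechet_derivative f (at x) v)"
  using assms frechet_derivative_works by auto

lemma k_smooth_on_Suc_imp: "k_smooth_on (Suc k) S f \<Longrightarrow> k_smooth_on k S f"
proof (induction k arbitrary: f)
  case 0
  then show ?case
    by (simp add: continuous_at_imp_continuous_on differentiable_imp_continuous_within)
next
  case (Suc k)
  then show ?case by (metis k_smooth_on.simps(2))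
qed

lemma k_smooth_on_subset: "k_smooth_on k S f \<Longrightarrow> T \<subseteq> S \<Longrightarrow> k_smooth_on k T f"
  by (induction k arbitrary: f) (auto intro: continuous_on_subset)

lemma k_smooth_on_locally:
  assumes "\<And>x. x \<in> S \<Longrightarrow> \<exists>T. open T \<and> x \<in> T \<and> k_smooth_on k T f"
  shows "k_smooth_on k S f"
  using assms
proof (induction k arbitrary: f)
  case 0
  then have "isCont f x" if "x \<in> S" for x
    using that by (metis continuous_on_eq_continuous_at k_smooth_on.simps(1))
  then show ?case by (simp add: continuous_at_imp_continuous_on)
next
  case (Suc k)
  then show ?case unfolding k_smooth_on.simps by metis
qed

lemma k_smooth_on_const: "open S \<Longrightarrow> k_smooth_on k S (\<lambda>x. c)"
  by (induction k arbitrary: c) auto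

lemma k_smooth_on_bounded_linear:
  assumes "open S" and "bounded_linear L" and "k_smooth_on k S f"
  shows "k_smooth_on k S (\<lambda>x. L (f x))"
  using assms(3)
proof (induction k arbitrary: f)
  case 0
  then show ?case using bounded_linear.continuous_on[OF assms(2)] by simp
next
  case (Suc k)
  show ?case
    by (rule k_smooth_on_SucI[OF assms(1)])
      (rule bounded_linear.has_derivative[OF assms(2)] Suc.IH k_smooth_on_SucD[OF Suc.prems],
        assumption?)+
qed

lemma k_smooth_on_ident: "open S \<Longrightarrow> k_smooth_on k S (\<lambda>x. x)"
  by (cases k) (auto simp: k_smooth_on_const)

lemma k_smooth_on_add:
  assumes "open S" and "k_smooth_on k S f" and "k_smooth_on k S g"
  shows "k_smooth_on k S (\<lambda>x. f x + g x)"
  using assms(2,3)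
proof (induction k arbitrary: f g)
  case 0
  then show ?case by (simp add: continuous_on_add)
next
  case (Suc k)
  show ?case
    by (rule k_smooth_on_SucI[OF assms(1)])
      (rule has_derivative_add Suc.IH k_smooth_on_SucD[OF Suc.prems(1)]
        k_smooth_on_SucD[OF Suc.prems(2)], assumption?)+
qed

lemma k_smooth_on_sum:
  assumes "open S" and "\<And>i. i \<in> B \<Longrightarrow> k_smooth_on k S (f i)"
  shows "k_smooth_on k S (\<lambda>x. \<Sum>i\<in>B. f i x)"
  using assms(2)
proof (induction B rule: infinite_finite_induct)
  case (insert i B)
  then show ?case by (simp add: k_smooth_on_add[OF assms(1)])
qed (auto simp: k_smooth_on_const[OF assms(1)])

lemma k_smooth_on_scaleR:
  assumes "open S" and "k_smooth_on k S f" and "k_smooth_on k S g"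
  shows "k_smooth_on k S (\<lambda>x. f x *\<^sub>R g x)"
  using assms(2,3)
proof (induction k arbitrary: f g)
  case 0
  then show ?case by (simp add: continuous_on_scaleR)
next
  case (Suc k)
  note D = k_smooth_on_SucD[OF Suc.prems(1)] k_smooth_on_SucD[OF Suc.prems(2)]
  note fg = k_smooth_on_Suc_imp[OF Suc.prems(1)] k_smooth_on_Suc_imp[OF Suc.prems(2)]
  show ?case
  proof (rule k_smooth_on_SucI[OF assms(1)])
    show "((\<lambda>x. f x *\<^sub>R g x) has_derivative
        (\<lambda>v. f x *\<^sub>R frechet_derivative g (at x) v + frechet_derivative f (at x) v *\<^sub>R g x)) (at x)"
      if "x \<in> S" for x
      using has_derivative_scaleR[OF D(1)[OF that] D(3)[OF that]] .
    show "k_smooth_on k S (\<lambda>x. f x *\<^sub>R frechet_derivative g (at x) v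
        + frechet_derivative f (at x) v *\<^sub>R g x)" for v
      by (rule k_smooth_on_add[OF assms(1) Suc.IH[OF fg(1) D(4)] Suc.IH[OF D(2) fg(2)]])
  qed
qed

lemma k_smooth_on_Pair:
  assumes "open S" and "k_smooth_on k S f" and "k_smooth_on k S g"
  shows "k_smooth_on k S (\<lambda>x. (f x, g x))"
proof -
  have "k_smooth_on k S (\<lambda>x. (f x, 0) + (0, g x))"
    by (intro k_smooth_on_add k_smooth_on_bounded_linear[of _ "\<lambda>y. (y, 0)"]
        k_smooth_on_bounded_linear[of _ "\<lambda>y. (0, y)"] assms)
      (auto intro: bounded_linear_Pair bounded_linear_ident bounded_linear_zero)
  then show ?thesis by simp
qed

text \<open>
  The recursion for \<open>k_smooth_on\<close> differentiates in a fixed direction, whereas the chain rule produces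
  the derivative of \<open>g\<close> in the direction \<open>Df(x) v\<close>, which moves with \<open>x\<close>. Expanding that direction in the
  standard basis leaves a sum of products, to which the induction hypothesis applies.
\<close>
lemma k_smooth_on_compose:
  fixes f :: "'a::euclidean_space \<Rightarrow> 'b::euclidean_space"
    and g :: "'b \<Rightarrow> 'c::real_normed_vector"
  assumes "open S" and "open T" and "f ` S \<subseteq> T"
    and "k_smooth_on k S f" and "k_smooth_on k T g"
  shows "k_smooth_on k S (\<lambda>x. g (f x))"
  using assms(4,5)
proof (induction k arbitrary: g)
  case 0
  then show ?case using continuous_on_compose2 assms(3) by (metis k_smooth_on.simps(1))
next
  case (Suc k)
  note Df = k_smooth_on_SucD[OF Suc.prems(1)] and Dg = k_smooth_on_SucD[OF Suc.prems(2)]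
  let ?D = "\<lambda>x v. \<Sum>b\<in>Basis. (frechet_derivative f (at x) v \<bullet> b) *\<^sub>R frechet_derivative g (at (f x)) b"
  show ?case
  proof (rule k_smooth_on_SucI[OF assms(1)])
    fix x assume x: "x \<in> S"
    then have fx: "f x \<in> T" using assms(3) by auto
    have lin: "linear (frechet_derivative g (at (f x)))"
      using Dg(1)[OF fx] by (simp add: has_derivative_linear)
    have "frechet_derivative g (at (f x)) (frechet_derivative f (at x) v) = ?D x v" for v
      by (subst euclidean_representation[symmetric, of "frechet_derivative f (at x) v"])
        (simp add: linear_sum[OF lin] linear_scale[OF lin])
    then show "((\<lambda>x. g (f x)) has_derivative ?D x) (at x)"
      using has_derivative_compose[OF Df(1)[OF x] Dg(1)[OF fx]] by simp
  next
    fix v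
    show "k_smooth_on k S (\<lambda>x. ?D x v)"
      by (rule k_smooth_on_sum[OF assms(1)] k_smooth_on_scaleR[OF assms(1)]
          k_smooth_on_bounded_linear[OF assms(1) bounded_linear_inner_left] Df
          Suc.IH[OF k_smooth_on_Suc_imp[OF Suc.prems(1)]] Dg)+
  qed
qed

lemma k_smooth_on_powr:
  fixes a :: real
  shows "k_smooth_on k {0<..} (\<lambda>x. x powr a)"
proof (induction k arbitrary: a)
  case 0
  then show ?case by (auto intro!: continuous_intros)
next
  case (Suc k)
  show ?case
  proof (rule k_smooth_on_SucI)
    show "((\<lambda>x. x powr a) has_derivative (\<lambda>v. v *\<^sub>R (a *\<^sub>R x powr (a - 1)))) (at x)"
      if "x \<in> {0<..}" for x :: real
      using that has_real_derivative_powr[of x a, unfolded has_field_derivative_def]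
      by (auto elim!: has_derivative_eq_rhs)
    show "k_smooth_on k {0<..} (\<lambda>x. v *\<^sub>R (a *\<^sub>R x powr (a - 1)))" for v
      by (rule k_smooth_on_bounded_linear[OF _ bounded_linear_scaleR_right
            k_smooth_on_bounded_linear[OF _ bounded_linear_scaleR_right Suc]]) auto
  qed auto
qed

lemma smooth_on_subset: "smooth_on S f \<Longrightarrow> T \<subseteq> S \<Longrightarrow> smooth_on T f"
  unfolding smooth_on_def using k_smooth_on_subset by blast

lemma smooth_on_cong:
  "open S \<Longrightarrow> (\<And>x. x \<in> S \<Longrightarrow> f x = g x) \<Longrightarrow> smooth_on S f \<Longrightarrow> smooth_on S g"
  unfolding smooth_on_def using k_smooth_on_cong by blast

lemma smooth_on_locally:
  "(\<And>x. x \<in> S \<Longrightarrow> \<exists>T. open T \<and> x \<in> T \<and> smooth_on T f) \<Longrightarrow> smooth_on S f"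
  unfolding smooth_on_def using k_smooth_on_locally by metis

lemma smooth_on_compose:
  fixes f :: "'a::euclidean_space \<Rightarrow> 'b::euclidean_space"
  assumes "open S" and "open T" and "f ` S \<subseteq> T" and "smooth_on S f" and "smooth_on T g"
  shows "smooth_on S (\<lambda>x. g (f x))"
  using assms k_smooth_on_compose unfolding smooth_on_def by blast

lemma smooth_on_Pair:
  "open S \<Longrightarrow> smooth_on S f \<Longrightarrow> smooth_on S g \<Longrightarrow> smooth_on S (\<lambda>x. (f x, g x))"
  unfolding smooth_on_def using k_smooth_on_Pair by blast

lemma smooth_on_add:
  "open S \<Longrightarrow> smooth_on S f \<Longrightarrow> smooth_on S g \<Longrightarrow> smooth_on S (\<lambda>x. f x + g x)"
  unfolding smooth_on_def using k_smooth_on_add by blast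

lemma smooth_on_const: "open S \<Longrightarrow> smooth_on S (\<lambda>x. c)"
  unfolding smooth_on_def using k_smooth_on_const by blast

lemma smooth_on_bounded_linear_comp:
  "open S \<Longrightarrow> bounded_linear L \<Longrightarrow> smooth_on S f \<Longrightarrow> smooth_on S (\<lambda>x. L (f x))"
  unfolding smooth_on_def using k_smooth_on_bounded_linear by blast

lemma smooth_on_bounded_linear: "open S \<Longrightarrow> bounded_linear L \<Longrightarrow> smooth_on S L"
  unfolding smooth_on_def using k_smooth_on_bounded_linear k_smooth_on_ident by blast

lemma smooth_on_powr: "smooth_on {0<..} (\<lambda>x::real. x powr a)"
  unfolding smooth_on_def using k_smooth_on_powr by blast

lemma smooth_on_imp_continuous_on: "smooth_on S f \<Longrightarrow> continuous_on S f"
  unfolding smooth_on_def using k_smooth_on.simps(1) by blast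

lemma smooth_on_has_derivative:
  "smooth_on S f \<Longrightarrow> x \<in> S \<Longrightarrow> (f has_derivative frechet_derivative f (at x)) (at x)"
  unfolding smooth_on_def using k_smooth_on_SucD(1) by blast

lemma smooth_on_frechet_derivative:
  "smooth_on S f \<Longrightarrow> smooth_on S (\<lambda>x. frechet_derivative f (at x) v)"
  unfolding smooth_on_def using k_smooth_on_SucD(2) by blast

section \<open>Symmetry of the second derivative\<close>

text \<open>
  The mean value theorem, first in the direction \<open>v\<close> and then in the direction \<open>w\<close>. The left-hand
  side is symmetric in \<open>v\<close> and \<open>w\<close>, which is the source of the symmetry of second derivatives.
\<close>
lemma second_difference_mean_value:
  fixes f :: "'a::euclidean_space \<Rightarrow> real"
  assumes "smooth_on S f" and "h > 0"
    and box: "\<And>s t. 0 \<le> s \<Longrightarrow> s \<le> h \<Longrightarrow> 0 \<le> t \<Longrightarrow> t \<le> h \<Longrightarrow> x + s *\<^sub>R v + t *\<^sub>R w \<in> S"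
  obtains s t where "0 < s" "s < h" "0 < t" "t < h"
    "f (x + h *\<^sub>R v + h *\<^sub>R w) - f (x + h *\<^sub>R v) - f (x + h *\<^sub>R w) + f x
      = h * h * frechet_derivative (\<lambda>y. frechet_derivative f (at y) v) (at (x + s *\<^sub>R v + t *\<^sub>R w)) w"
proof -
  let ?D = "\<lambda>y. frechet_derivative f (at y)"
  have line: "((\<lambda>s. F (p + s *\<^sub>R u)) has_real_derivative frechet_derivative F (at (p + s *\<^sub>R u)) u) (at s)"
    if "smooth_on S F" "p + s *\<^sub>R u \<in> S" for F :: "'a \<Rightarrow> real" and p u s
  proof -
    have "((\<lambda>s. p + s *\<^sub>R u) has_derivative (\<lambda>r. r *\<^sub>R u)) (at s)"
      by (auto intro!: derivative_eq_intros)
    from has_derivative_compose[OF this smooth_on_has_derivative[OF that]]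
    show ?thesis unfolding has_field_derivative_def
      by (rule has_derivative_eq_rhs)
        (auto simp: linear_scale[OF has_derivative_linear[OF smooth_on_has_derivative[OF that]]])
  qed
  \<comment> \<open>applied to the difference of \<open>f\<close> on the two sides of the parallelogram parallel to \<open>v\<close>\<close>
  have "\<exists>s. 0 < s \<and> s < h \<and>
      (f ((x + h *\<^sub>R w) + h *\<^sub>R v) - f (x + h *\<^sub>R v)) - (f ((x + h *\<^sub>R w) + 0 *\<^sub>R v) - f (x + 0 *\<^sub>R v))
      = (h - 0) * (?D ((x + h *\<^sub>R w) + s *\<^sub>R v) v - ?D (x + s *\<^sub>R v) v)"
    using assms(2) box[of _ h] box[of _ 0]
    by (intro MVT2 DERIV_diff line assms(1)) (auto simp: algebra_simps)
  then obtain s where s: "0 < s" "s < h"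
    "f (x + h *\<^sub>R v + h *\<^sub>R w) - f (x + h *\<^sub>R v) - f (x + h *\<^sub>R w) + f x
      = h * (?D (x + s *\<^sub>R v + h *\<^sub>R w) v - ?D (x + s *\<^sub>R v) v)"
    by (auto simp: algebra_simps)
  have "\<exists>t. 0 < t \<and> t < h \<and>
      ?D (x + s *\<^sub>R v + h *\<^sub>R w) v - ?D (x + s *\<^sub>R v + 0 *\<^sub>R w) v
      = (h - 0) * frechet_derivative (\<lambda>y. ?D y v) (at (x + s *\<^sub>R v + t *\<^sub>R w)) w"
    using assms(2) s box
    by (intro MVT2 line smooth_on_frechet_derivative assms(1)) auto
  then show thesis using s that by auto
qed

text \<open>
  Both orders of differentiation are limits of the same second difference quotient. If they differed,
  continuity would keep them apart on a parallelogram small enough for the mean value theorem to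
  yield equal values.
\<close>
lemma mixed_partial_derivatives_commute_real:
  fixes f :: "'a::euclidean_space \<Rightarrow> real"
  assumes "open S" and "smooth_on S f" and "x \<in> S"
  shows "frechet_derivative (\<lambda>y. frechet_derivative f (at y) v) (at x) w
       = frechet_derivative (\<lambda>y. frechet_derivative f (at y) w) (at x) v"
proof (rule ccontr)
  let ?D = "\<lambda>v w y. frechet_derivative (\<lambda>z. frechet_derivative f (at z) v) (at y) w"
  define \<epsilon> where "\<epsilon> = \<bar>?D v w x - ?D w v x\<bar> / 2"
  assume "?D v w x \<noteq> ?D w v x"
  then have "\<epsilon> > 0" by (simp add: \<epsilon>_def)
  have cont: "continuous (at x) (?D v w)" for v w
    using smooth_on_imp_continuous_on[OF smooth_on_frechet_derivative[OF smooth_on_frechet_derivative[OF assms(2)]]]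
      assms(1,3) continuous_on_eq_continuous_at by blast
  obtain d1 where d1: "d1 > 0" "\<And>y. dist y x < d1 \<Longrightarrow> dist (?D v w y) (?D v w x) < \<epsilon>"
    using cont[of v w] \<open>\<epsilon> > 0\<close> unfolding continuous_at_eps_delta by blast
  obtain d2 where d2: "d2 > 0" "\<And>y. dist y x < d2 \<Longrightarrow> dist (?D w v y) (?D w v x) < \<epsilon>"
    using cont[of w v] \<open>\<epsilon> > 0\<close> unfolding continuous_at_eps_delta by blast
  obtain d3 where d3: "d3 > 0" "ball x d3 \<subseteq> S"
    using assms(1,3) openE by blast
  define d where "d = min d1 (min d2 d3)"
  define h where "h = d / (norm v + norm w + 1)"
  have d: "d > 0" using d1 d2 d3 by (simp add: d_def)
  have h: "h > 0" using d by (simp add: h_def add_nonneg_pos)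
  have near: "dist (x + s *\<^sub>R v + t *\<^sub>R w) x < d" if "0 \<le> s" "s \<le> h" "0 \<le> t" "t \<le> h" for s t
  proof -
    have "dist (x + s *\<^sub>R v + t *\<^sub>R w) x \<le> s * norm v + t * norm w"
      using norm_triangle_ineq[of "s *\<^sub>R v" "t *\<^sub>R w"] that by (simp add: dist_norm)
    also have "\<dots> \<le> h * norm v + h * norm w"
      using that by (intro add_mono mult_right_mono) auto
    also have "\<dots> < h * (norm v + norm w + 1)" using h by (simp add: algebra_simps)
    also have "\<dots> = d" unfolding h_def
      by (metis add_nonneg_pos add_nonneg_nonneg less_numeral_extra(1) norm_ge_zero nonzero_eq_divide_eq less_irrefl)
    finally show ?thesis .
  qed
  have "x + s *\<^sub>R v + t *\<^sub>R w \<in> S" "x + s *\<^sub>R w + t *\<^sub>R v \<in> S"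
    if "0 \<le> s" "s \<le> h" "0 \<le> t" "t \<le> h" for s t
    using near[of s t] near[of t s] d3 that unfolding d_def
    by (auto simp: subset_iff dist_commute algebra_simps)
  note box = this
  obtain s t where st: "0 < s" "s < h" "0 < t" "t < h"
    "f (x + h *\<^sub>R v + h *\<^sub>R w) - f (x + h *\<^sub>R v) - f (x + h *\<^sub>R w) + f x = h * h * ?D v w (x + s *\<^sub>R v + t *\<^sub>R w)"
    by (rule second_difference_mean_value[OF assms(2) h box(1)])
  obtain s' t' where st': "0 < s'" "s' < h" "0 < t'" "t' < h"
    "f (x + h *\<^sub>R w + h *\<^sub>R v) - f (x + h *\<^sub>R w) - f (x + h *\<^sub>R v) + f x = h * h * ?D w v (x + s' *\<^sub>R w + t' *\<^sub>R v)"
    by (rule second_difference_mean_value[OF assms(2) h box(2)])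
  have "h * h * ?D v w (x + s *\<^sub>R v + t *\<^sub>R w) = h * h * ?D w v (x + s' *\<^sub>R w + t' *\<^sub>R v)"
    using st(5) st'(5) by (simp add: algebra_simps)
  then have eq: "?D v w (x + s *\<^sub>R v + t *\<^sub>R w) = ?D w v (x + s' *\<^sub>R w + t' *\<^sub>R v)"
    using h by simp
  have "dist (x + s' *\<^sub>R w + t' *\<^sub>R v) x < d"
    using near[of t' s'] st' by (simp add: algebra_simps)
  then have "dist (?D v w (x + s *\<^sub>R v + t *\<^sub>R w)) (?D v w x) < \<epsilon>"
    "dist (?D w v (x + s' *\<^sub>R w + t' *\<^sub>R v)) (?D w v x) < \<epsilon>"
    using d1 d2 near[of s t] st by (auto simp: d_def)
  then have "dist (?D v w x) (?D w v x) < \<epsilon> + \<epsilon>"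
    unfolding eq
    using dist_triangle3[of "?D v w x" "?D w v x" "?D w v (x + s' *\<^sub>R w + t' *\<^sub>R v)"]
    by linarith
  then show False by (simp add: \<epsilon>_def dist_real_def)
qed

lemma frechet_derivative_inner:
  "f differentiable (at x) \<Longrightarrow> frechet_derivative (\<lambda>y. f y \<bullet> b) (at x) v = frechet_derivative f (at x) v \<bullet> b"
  using frechet_derivative_at[OF has_derivative_inner_left]
  by (metis frechet_derivative_works)

lemma mixed_partial_derivatives_commute:
  fixes f :: "'a::euclidean_space \<Rightarrow> 'b::euclidean_space"
  assumes "open S" and "smooth_on S f" and "x \<in> S"
  shows "frechet_derivative (\<lambda>y. frechet_derivative f (at y) v) (at x) w
       = frechet_derivative (\<lambda>y. frechet_derivative f (at y) w) (at x) v"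
proof (rule euclidean_eqI)
  fix b :: 'b
  have diff: "F differentiable (at y)" if "smooth_on S F" "y \<in> S" for F :: "'a \<Rightarrow> 'b" and y
    using smooth_on_has_derivative[OF that] differentiableI by blast
  have sm: "smooth_on S (\<lambda>y. f y \<bullet> b)"
    by (rule smooth_on_bounded_linear_comp[OF assms(1) bounded_linear_inner_left assms(2)])
  have "frechet_derivative (\<lambda>y. frechet_derivative (\<lambda>y. f y \<bullet> b) (at y) v) (at x) w
      = frechet_derivative (\<lambda>y. frechet_derivative f (at y) v \<bullet> b) (at x) w" for v w
    by (rule fun_cong[OF frechet_derivative_transform_within_open[OF _ assms(1,3)]],
        rule differentiableI[OF smooth_on_has_derivative[OF smooth_on_frechet_derivative[OF sm] assms(3)]],
        rule frechet_derivative_inner[OF diff[OF assms(2)]])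
  also have "frechet_derivative (\<lambda>y. frechet_derivative f (at y) v \<bullet> b) (at x) w
      = frechet_derivative (\<lambda>y. frechet_derivative f (at y) v) (at x) w \<bullet> b" for v w
    using diff[OF smooth_on_frechet_derivative[OF assms(2)] assms(3)] by (rule frechet_derivative_inner)
  finally show "frechet_derivative (\<lambda>y. frechet_derivative f (at y) v) (at x) w \<bullet> b
       = frechet_derivative (\<lambda>y. frechet_derivative f (at y) w) (at x) v \<bullet> b"
    using mixed_partial_derivatives_commute_real[OF assms(1) sm assms(3)] by metis
qed

section \<open>Tangent vectors in charts\<close>

definition smooth_map ::
  "'m topology \<Rightarrow> ('m, 'e::euclidean_space) chart set \<Rightarrow> ('m \<Rightarrow> 'm) \<Rightarrow> bool" where
  "smooth_map X A F \<longleftrightarrow> continuous_map X X F \<and>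
     (\<forall>(U, \<phi>)\<in>A. \<forall>(V, \<psi>)\<in>A.
        smooth_on {y \<in> \<phi> ` U. F (inv_into U \<phi> y) \<in> V} (\<lambda>y. \<psi> (F (inv_into U \<phi> y))))"

locale manifold =
  fixes X :: "'m topology" and A :: "('m, 'e::euclidean_space) chart set"
  assumes smooth_manifold: "smooth_manifold X A"
begin

lemma chart_exists:
  assumes "p \<in> topspace X"
  obtains U \<phi> where "(U, \<phi>) \<in> A" "p \<in> U"
  using assms smooth_manifold unfolding smooth_manifold_def by blast

lemma transition_smooth:
  "(U, \<phi>) \<in> A \<Longrightarrow> (V, \<psi>) \<in> A \<Longrightarrow> smooth_on (\<phi> ` (U \<inter> V)) (\<lambda>x. \<psi> (inv_into U \<phi> x))"
  using smooth_manifold unfolding smooth_manifold_def by blast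

context
  fixes U \<phi> assumes chart: "(U, \<phi>) \<in> A"
begin

lemma chart_homeomorphic: "homeomorphic_map (subtopology X U) (top_of_set (\<phi> ` U)) \<phi>"
  and chart_open: "openin X U"
  and chart_open_image: "open (\<phi> ` U)"
  using smooth_manifold chart unfolding smooth_manifold_def by blast+

lemma chart_subset: "U \<subseteq> topspace X"
  using chart_open by (rule openin_subset)

lemma chart_inj: "inj_on \<phi> U"
  using homeomorphic_imp_injective_map[OF chart_homeomorphic] chart_subset
  by (simp add: Int_absorb1)

lemma chart_inv: "p \<in> U \<Longrightarrow> inv_into U \<phi> (\<phi> p) = p"
  using chart_inj by simp

lemma chart_image_open:
  assumes "openin X V" shows "open (\<phi> ` (U \<inter> V))"
proof -
  have "openin (subtopology X U) (U \<inter> V)"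
    using assms by (simp add: openin_subtopology_Int2)
  then have "openin (top_of_set (\<phi> ` U)) (\<phi> ` (U \<inter> V))"
    using homeomorphic_imp_open_map[OF chart_homeomorphic] by (simp add: open_map_def)
  then show ?thesis using chart_open_image openin_open_trans by blast
qed

lemma chart_image_eq: "{x \<in> \<phi> ` U. inv_into U \<phi> x \<in> V} = \<phi> ` (U \<inter> V)"
  using chart_inv by auto

lemma chart_preimage_open:
  assumes "open W" shows "openin X {p \<in> U. \<phi> p \<in> W}"
proof -
  have "openin (top_of_set (\<phi> ` U)) (\<phi> ` U \<inter> W)"
    using assms by (simp add: openin_open_Int)
  then have "openin (subtopology X U) {p \<in> topspace (subtopology X U). \<phi> p \<in> \<phi> ` U \<inter> W}"
    by (rule openin_continuous_map_preimage[OF homeomorphic_imp_continuous_map[OF chart_homeomorphic]])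
  then have "openin X {p \<in> topspace (subtopology X U). \<phi> p \<in> \<phi> ` U \<inter> W}"
    using chart_open openin_trans_full by blast
  moreover have "{p \<in> topspace (subtopology X U). \<phi> p \<in> \<phi> ` U \<inter> W} = {p \<in> U. \<phi> p \<in> W}"
    using chart_subset by auto
  ultimately show ?thesis by simp
qed

lemma chart_inv_continuous: "continuous_map (top_of_set (\<phi> ` U)) X (inv_into U \<phi>)"
proof (rule continuous_map_openin_preimage_eq[THEN iffD2], intro conjI allI impI)
  show "inv_into U \<phi> \<in> topspace (top_of_set (\<phi> ` U)) \<rightarrow> topspace X"
    by (intro funcsetI subsetD[OF chart_subset] inv_into_into) simp
next
  fix V assume "openin X V"
  then have "open (\<phi> ` (U \<inter> V))" by (rule chart_image_open)
  then have "openin (top_of_set (\<phi> ` U)) (\<phi> ` (U \<inter> V))"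
    by (rule open_subset[rotated]) auto
  moreover have "topspace (top_of_set (\<phi> ` U)) \<inter> inv_into U \<phi> -` V = \<phi> ` (U \<inter> V)"
    using chart_image_eq[of V] by auto
  ultimately show "openin (top_of_set (\<phi> ` U)) (topspace (top_of_set (\<phi> ` U)) \<inter> inv_into U \<phi> -` V)"
    by simp
qed

end

context
  fixes U \<phi> assumes chart: "(U, \<phi>) \<in> A"
begin

text \<open>
  The definition of \<open>smooth_near\<close> offers some chart around \<open>p\<close>. A transition map carries smoothness over
  to any given one, which makes coordinate vectors in different charts comparable.
\<close>
lemma smooth_near_in_chart:
  assumes "p \<in> U" and "smooth_near A p u"
  obtains W where "open W" "\<phi> p \<in> W" "W \<subseteq> \<phi> ` U" "smooth_on W (\<lambda>x. u (inv_into U \<phi> x))"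
proof -
  obtain V \<psi> N where N: "(V, \<psi>) \<in> A" "p \<in> V" "open N" "\<psi> p \<in> N" "N \<subseteq> \<psi> ` V"
    "smooth_on N (\<lambda>x. u (inv_into V \<psi> x))"
    using assms(2) unfolding smooth_near_def by blast
  define Q where "Q = {q \<in> V. \<psi> q \<in> N}"
  have "openin X Q"
    unfolding Q_def by (rule chart_preimage_open[OF N(1,3)])
  define W where "W = \<phi> ` (U \<inter> Q)"
  have W: "open W" unfolding W_def by (rule chart_image_open[OF chart]) fact
  have "smooth_on W (\<lambda>x. u (inv_into V \<psi> (\<psi> (inv_into U \<phi> x))))"
  proof (rule smooth_on_compose[OF W N(3) _ _ N(6)])
    show "(\<lambda>x. \<psi> (inv_into U \<phi> x)) ` W \<subseteq> N"
      by (auto simp: W_def Q_def chart_inv[OF chart])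
    show "smooth_on W (\<lambda>x. \<psi> (inv_into U \<phi> x))"
      by (rule smooth_on_subset[OF transition_smooth[OF chart N(1)]]) (auto simp: W_def Q_def)
  qed
  then have "smooth_on W (\<lambda>x. u (inv_into U \<phi> x))"
    by (rule smooth_on_cong[OF W, rotated])
      (auto simp: W_def Q_def chart_inv[OF chart] chart_inv[OF N(1)])
  then show thesis using W assms(1) N(2,4) by (intro that[of W]) (auto simp: W_def Q_def)
qed

lemma smooth_near_has_derivative:
  assumes "p \<in> U" and "smooth_near A p u"
  shows "((\<lambda>x. u (inv_into U \<phi> x)) has_derivative (\<lambda>v. coordinate_vector A (U, \<phi>) p v u))
    (at (\<phi> p))"
proof -
  obtain W where "\<phi> p \<in> W" "smooth_on W (\<lambda>x. u (inv_into U \<phi> x))"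
    by (rule smooth_near_in_chart[OF assms])
  then show ?thesis
    using smooth_on_has_derivative[of W] assms(2) by (simp add: coordinate_vector_def)
qed

lemma coordinate_vector_linear:
  assumes "p \<in> U"
  shows "coordinate_vector A (U, \<phi>) p (a *\<^sub>R v + b *\<^sub>R w)
    = (\<lambda>u. a * coordinate_vector A (U, \<phi>) p v u + b * coordinate_vector A (U, \<phi>) p w u)"
proof
  fix u
  show "coordinate_vector A (U, \<phi>) p (a *\<^sub>R v + b *\<^sub>R w) u
    = a * coordinate_vector A (U, \<phi>) p v u + b * coordinate_vector A (U, \<phi>) p w u"
  proof (cases "smooth_near A p u")
    case True
    have "linear (\<lambda>v. coordinate_vector A (U, \<phi>) p v u)"
      using smooth_near_has_derivative[OF assms True] by (rule has_derivative_linear)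
    then show ?thesis by (simp add: linear_iff)
  qed (simp add: coordinate_vector_def)
qed

text \<open>
  The coordinates of a tangent vector are its values on the coordinate functions of the chart.
\<close>
lemma coordinate_vector_eq_0D:
  assumes "p \<in> U" and "coordinate_vector A (U, \<phi>) p v = (\<lambda>_. 0)"
  shows "v = 0"
proof (rule euclidean_eqI)
  fix b :: 'e
  have "smooth_on (\<phi> ` U) (\<lambda>x. \<phi> (inv_into U \<phi> x) \<bullet> b)"
    by (rule smooth_on_cong[OF chart_open_image[OF chart] _
          smooth_on_bounded_linear[OF chart_open_image[OF chart] bounded_linear_inner_left]])
      (simp add: f_inv_into_f)
  then have near: "smooth_near A p (\<lambda>q. \<phi> q \<bullet> b)"
    unfolding smooth_near_def using chart assms(1) chart_open_image[OF chart] by blast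
  have "((\<lambda>x. \<phi> (inv_into U \<phi> x) \<bullet> b) has_derivative (\<lambda>v. v \<bullet> b)) (at (\<phi> p))"
    by (rule has_derivative_transform_within_open[OF _ chart_open_image[OF chart],
          OF bounded_linear_imp_has_derivative[OF bounded_linear_inner_left]])
      (use assms(1) in \<open>auto simp: f_inv_into_f\<close>)
  then have "(\<lambda>v. v \<bullet> b) = (\<lambda>v. coordinate_vector A (U, \<phi>) p v (\<lambda>q. \<phi> q \<bullet> b))"
    using smooth_near_has_derivative[OF assms(1) near] by (rule has_derivative_unique)
  then show "v \<bullet> b = 0 \<bullet> b" using assms(2) by (metis inner_zero_left)
qed

lemma derivative_along_curve:
  assumes "\<gamma> t \<in> U" and "\<forall>\<^sub>F s in nhds t. \<gamma> s \<in> U"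
    and "((\<lambda>s. \<phi> (\<gamma> s)) has_vector_derivative c') (at t)" and "smooth_near A (\<gamma> t) u"
  shows "((\<lambda>s. u (\<gamma> s)) has_real_derivative coordinate_vector A (U, \<phi>) (\<gamma> t) c' u) (at t)"
proof -
  have D: "((\<lambda>x. u (inv_into U \<phi> x)) has_derivative (\<lambda>v. coordinate_vector A (U, \<phi>) (\<gamma> t) v u))
      (at (\<phi> (\<gamma> t)))"
    by (rule smooth_near_has_derivative[OF assms(1,4)])
  have "((\<lambda>s. u (inv_into U \<phi> (\<phi> (\<gamma> s)))) has_real_derivative
      coordinate_vector A (U, \<phi>) (\<gamma> t) c' u) (at t)"
    unfolding has_field_derivative_def
    by (rule has_derivative_eq_rhs[OF has_derivative_compose[OF
          assms(3)[unfolded has_vector_derivative_def] D]])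
      (simp add: fun_eq_iff linear_scale[OF has_derivative_linear[OF D]])
  moreover have "\<forall>\<^sub>F s in nhds t. u (inv_into U \<phi> (\<phi> (\<gamma> s))) = u (\<gamma> s)"
    using assms(2) by eventually_elim (simp add: chart_inv[OF chart])
  ultimately show ?thesis by (simp add: DERIV_cong_ev[OF refl _ refl])
qed

text \<open>
  The passage from tangent vectors as operators to their coordinates: by the chain rule, both sides
  differentiate a function along the curve.
\<close>
lemma velocity_eq_coordinate_vector:
  assumes "\<gamma> t \<in> U" and "\<forall>\<^sub>F s in nhds t. \<gamma> s \<in> U"
    and "((\<lambda>s. \<phi> (\<gamma> s)) has_vector_derivative c') (at t)"
  shows "velocity A \<gamma> t = coordinate_vector A (U, \<phi>) (\<gamma> t) c'"
proof
  fix u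
  show "velocity A \<gamma> t u = coordinate_vector A (U, \<phi>) (\<gamma> t) c' u"
    using DERIV_imp_deriv[OF derivative_along_curve[OF assms]]
    by (cases "smooth_near A (\<gamma> t) u") (auto simp: velocity_def coordinate_vector_def)
qed

text \<open>
  A straight line in the chart, restricted to parameters for which it stays in the chart, has the
  prescribed velocity.
\<close>
lemma coordinate_vector_in_tangent_space:
  assumes p: "p \<in> U"
  shows "coordinate_vector A (U, \<phi>) p v \<in> tangent_space X A p"
proof -
  obtain d where d: "d > 0" "ball (\<phi> p) d \<subseteq> \<phi> ` U"
    using openE[OF chart_open_image[OF chart] imageI[OF p]] by blast
  define e where "e = d / (norm v + 1)"
  have e: "e > 0" using d by (simp add: e_def add_nonneg_pos)
  define c where "c = (\<lambda>t. \<phi> p + t *\<^sub>R v)"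
  define \<gamma> where "\<gamma> = (\<lambda>t. inv_into U \<phi> (c t))"
  have c: "c t \<in> \<phi> ` U" if "t \<in> {-e<..<e}" for t
  proof -
    have "norm (t *\<^sub>R v) \<le> e * norm v" using that by (auto intro: mult_right_mono)
    also have "\<dots> < e * (norm v + 1)" using e by simp
    also have "\<dots> = d" using add_nonneg_pos[OF norm_ge_zero[of v] zero_less_one] by (simp add: e_def)
    finally have "c t \<in> ball (\<phi> p) d" by (simp add: c_def dist_norm)
    then show ?thesis using d(2) by blast
  qed
  then have \<gamma>: "\<gamma> t \<in> U" "\<phi> (\<gamma> t) = c t" if "t \<in> {-e<..<e}" for t
    using that by (auto simp: \<gamma>_def inv_into_into f_inv_into_f)
  have contc: "continuous_on T c" for T unfolding c_def by (intro continuous_intros)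
  have cont: "continuous_map (top_of_set {-e<..<e}) X \<gamma>"
    unfolding \<gamma>_def
    by (rule continuous_map_compose[OF _ chart_inv_continuous[OF chart], unfolded o_def])
      (use c contc in auto)
  have "smooth_on {t \<in> {-e<..<e}. \<gamma> t \<in> V} (\<lambda>t. \<psi> (\<gamma> t))" if V: "(V, \<psi>) \<in> A" for V \<psi>
  proof -
    note openV = chart_open[OF V]
    have "{t \<in> {-e<..<e}. \<gamma> t \<in> V} = {-e<..<e} \<inter> c -` (\<phi> ` (U \<inter> V))"
      unfolding chart_image_eq[OF chart, of V, symmetric] using c by (auto simp: \<gamma>_def)
    then have op: "open {t \<in> {-e<..<e}. \<gamma> t \<in> V}"
      using continuous_open_preimage[OF contc _ chart_image_open[OF chart openV]] by simp
    show ?thesis unfolding \<gamma>_def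
    proof (rule smooth_on_compose[OF _ chart_image_open[OF chart openV] _ _ transition_smooth[OF chart V]])
      show "open {t \<in> {-e<..<e}. inv_into U \<phi> (c t) \<in> V}" using op by (simp add: \<gamma>_def)
      then show "smooth_on {t \<in> {-e<..<e}. inv_into U \<phi> (c t) \<in> V} c" unfolding c_def
        by (intro smooth_on_add smooth_on_const smooth_on_bounded_linear bounded_linear_scaleR_left)
      show "c ` {t \<in> {-e<..<e}. inv_into U \<phi> (c t) \<in> V} \<subseteq> \<phi> ` (U \<inter> V)"
        unfolding chart_image_eq[OF chart, of V, symmetric] using c by auto
    qed
  qed
  then have curve: "smooth_curve X A {-e<..<e} \<gamma>"
    using cont unfolding smooth_curve_def by blast
  have \<gamma>0: "\<gamma> 0 = p" using p by (simp add: \<gamma>_def c_def chart_inv[OF chart])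
  have ev: "\<forall>\<^sub>F s in nhds 0. s \<in> {-e<..<e}"
    by (rule eventually_nhds_in_open) (use e in auto)
  have "(c has_vector_derivative v) (at 0)"
    unfolding c_def has_vector_derivative_def by (auto intro!: derivative_eq_intros)
  then have "((\<lambda>s. \<phi> (\<gamma> s)) has_vector_derivative v) (at 0)"
    by (rule has_vector_derivative_transform_within_open[where S = "{-e<..<e}"])
      (use e \<gamma> in auto)
  then have "velocity A \<gamma> 0 = coordinate_vector A (U, \<phi>) p v"
    using velocity_eq_coordinate_vector[of \<gamma> 0 v] \<gamma>0 p eventually_mono[OF ev \<gamma>(1)] by simp
  moreover have "\<gamma> ` {-e<..<e} \<subseteq> topspace X" using \<gamma>(1) chart_subset[OF chart] by auto
  ultimately show ?thesis
    unfolding tangent_space_of_def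
    by (intro CollectI exI[of _ \<gamma>] exI[of _ e] conjI) (simp_all only: \<gamma>0 curve e)
qed

lemma local_metric_chart:
  "p \<in> U \<Longrightarrow> local_metric A g (U, \<phi>) (\<phi> p) v w
    = g p (coordinate_vector A (U, \<phi>) p v) (coordinate_vector A (U, \<phi>) p w)"
  by (simp add: local_metric_def chart_inv[OF chart])

end

lemma continuous_map_preimage_open:
  assumes "continuous_map (top_of_set I) X \<gamma>" and "open I" and "openin X V"
  shows "open {t \<in> I. \<gamma> t \<in> V}"
proof -
  have "openin (top_of_set I) {t \<in> topspace (top_of_set I). \<gamma> t \<in> V}"
    using assms(1,3) by (rule openin_continuous_map_preimage)
  then show ?thesis using assms(2) openin_open_trans by (simp only: topspace_euclidean_subtopology)
qed

lemma smooth_curve_in_chart: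
  assumes "smooth_curve X A I \<gamma>" and "open I" and "(U, \<phi>) \<in> A"
  shows "open {t \<in> I. \<gamma> t \<in> U}" and "smooth_on {t \<in> I. \<gamma> t \<in> U} (\<lambda>t. \<phi> (\<gamma> t))"
proof -
  have "continuous_map (top_of_set I) X \<gamma>"
    using assms(1) by (simp add: smooth_curve_def)
  then show "open {t \<in> I. \<gamma> t \<in> U}"
    by (rule continuous_map_preimage_open[OF _ assms(2) chart_open[OF assms(3)]])
  show "smooth_on {t \<in> I. \<gamma> t \<in> U} (\<lambda>t. \<phi> (\<gamma> t))"
    using assms(1,3) unfolding smooth_curve_def by fast
qed

lemma tangent_space_eq_coordinate_vectors:
  assumes "(U, \<phi>) \<in> A" and "p \<in> U"
  shows "tangent_space X A p = range (coordinate_vector A (U, \<phi>) p)"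
proof
  show "range (coordinate_vector A (U, \<phi>) p) \<subseteq> tangent_space X A p"
    using coordinate_vector_in_tangent_space[OF assms] by auto
  show "tangent_space X A p \<subseteq> range (coordinate_vector A (U, \<phi>) p)"
  proof
    fix V assume "V \<in> tangent_space X A p"
    then obtain \<gamma> e where \<gamma>: "V = velocity A \<gamma> 0" "\<gamma> 0 = p" "e > 0" "smooth_curve X A {-e<..<e} \<gamma>"
      unfolding tangent_space_of_def by blast
    note c = smooth_curve_in_chart[OF \<gamma>(4) open_greaterThanLessThan assms(1)]
    have 0: "0 \<in> {t \<in> {-e<..<e}. \<gamma> t \<in> U}" using \<gamma> assms by auto
    have "(\<lambda>t. \<phi> (\<gamma> t)) differentiable (at 0)"
      using smooth_on_has_derivative[OF c(2) 0] differentiableI by blast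
    then have "((\<lambda>t. \<phi> (\<gamma> t)) has_vector_derivative vector_derivative (\<lambda>t. \<phi> (\<gamma> t)) (at 0)) (at 0)"
      by (simp add: vector_derivative_works)
    moreover have "\<forall>\<^sub>F s in nhds 0. \<gamma> s \<in> U"
      using eventually_nhds_in_open[OF c(1) 0] by (rule eventually_mono) simp
    ultimately show "V \<in> range (coordinate_vector A (U, \<phi>) p)"
      using velocity_eq_coordinate_vector[OF assms(1), of \<gamma> 0] \<gamma>(1,2) assms(2) by auto
  qed
qed

text \<open>
  Both \<open>velocity\<close> and \<open>pushforward\<close> are set to \<open>0\<close> on functions that are not smooth near the point, so
  pushing a velocity forward requires that smooth functions pull back to smooth functions.
\<close>
lemma smooth_near_compose:
  assumes F: "smooth_map X A F" and p: "p \<in> topspace X" and u: "smooth_near A (F p) u"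
  shows "smooth_near A p (\<lambda>q. u (F q))"
proof -
  have cont: "continuous_map X X F" using F by (simp add: smooth_map_def)
  obtain U \<phi> where U: "(U, \<phi>) \<in> A" "p \<in> U" by (rule chart_exists[OF p])
  have "F p \<in> topspace X" using cont p by (auto simp: continuous_map_def)
  then obtain V \<psi> where V: "(V, \<psi>) \<in> A" "F p \<in> V" by (rule chart_exists)
  obtain N where N: "open N" "\<psi> (F p) \<in> N" "N \<subseteq> \<psi> ` V" "smooth_on N (\<lambda>x. u (inv_into V \<psi> x))"
    by (rule smooth_near_in_chart[OF V u])
  define Q where "Q = {q \<in> topspace X. F q \<in> {r \<in> V. \<psi> r \<in> N}}"
  have "openin X Q" unfolding Q_def
    by (rule openin_continuous_map_preimage[OF cont chart_preimage_open[OF V(1) N(1)]])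
  define W where "W = \<phi> ` (U \<inter> Q)"
  have W: "open W" unfolding W_def by (rule chart_image_open[OF U(1)]) fact
  have "smooth_on W (\<lambda>x. u (inv_into V \<psi> (\<psi> (F (inv_into U \<phi> x)))))"
  proof (rule smooth_on_compose[OF W N(1) _ _ N(4)])
    show "(\<lambda>x. \<psi> (F (inv_into U \<phi> x))) ` W \<subseteq> N"
      by (auto simp: W_def Q_def chart_inv[OF U(1)])
    have "smooth_on {y \<in> \<phi> ` U. F (inv_into U \<phi> y) \<in> V} (\<lambda>y. \<psi> (F (inv_into U \<phi> y)))"
      using F U(1) V(1) unfolding smooth_map_def by blast
    then show "smooth_on W (\<lambda>x. \<psi> (F (inv_into U \<phi> x)))"
      by (rule smooth_on_subset) (auto simp: W_def Q_def chart_inv[OF U(1)])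
  qed
  then have "smooth_on W (\<lambda>x. u (F (inv_into U \<phi> x)))"
    by (rule smooth_on_cong[OF W, rotated])
      (auto simp: W_def Q_def chart_inv[OF U(1)] chart_inv[OF V(1)])
  moreover have "\<phi> p \<in> W" "W \<subseteq> \<phi> ` U"
    using U(2) V(2) N(2) p by (auto simp: W_def Q_def)
  ultimately show ?thesis unfolding smooth_near_def using U W by blast
qed

lemma pushforward_velocity:
  assumes "smooth_map X A F" and "\<gamma> t \<in> topspace X"
  shows "pushforward A F (\<gamma> t) (velocity A \<gamma> t) = velocity A (\<lambda>s. F (\<gamma> s)) t"
  using smooth_near_compose[OF assms] by (auto simp: pushforward_def velocity_def fun_eq_iff)

lemma smooth_function_imp_smooth_near:
  assumes "smooth_function A u" and "p \<in> topspace X"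
  shows "smooth_near A p u"
proof -
  obtain U \<phi> where "(U, \<phi>) \<in> A" "p \<in> U" by (rule chart_exists[OF assms(2)])
  then show ?thesis
    using assms(1) chart_open_image unfolding smooth_near_def smooth_function_def by blast
qed

section \<open>Metrics in charts\<close>

context
  fixes g assumes metric: "pseudo_riemannian_metric X A g"
begin

context
  fixes U \<phi> assumes chart: "(U, \<phi>) \<in> A"
begin

lemma local_metric_smooth: "smooth_on (\<phi> ` U) (\<lambda>x. local_metric A g (U, \<phi>) x v w)"
  using metric chart unfolding pseudo_riemannian_metric_def by blast

lemma
  assumes x: "x \<in> \<phi> ` U"
  shows local_metric_sym: "local_metric A g (U, \<phi>) x v w = local_metric A g (U, \<phi>) x w v"
    and local_metric_bilinear: "bilinear (local_metric A g (U, \<phi>) x)"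
    and local_metric_nondegenerate: "(\<And>u. local_metric A g (U, \<phi>) x z u = 0) \<Longrightarrow> z = 0"
proof -
  obtain p where p: "p \<in> U" "x = \<phi> p" using x by blast
  have top: "p \<in> topspace X" using p chart_subset[OF chart] by auto
  let ?C = "coordinate_vector A (U, \<phi>) p"
  have C: "?C v \<in> tangent_space X A p" for v
    by (rule coordinate_vector_in_tangent_space[OF chart p(1)])
  have
    "\<forall>V\<in>tangent_space X A p. \<forall>W\<in>tangent_space X A p. g p V W = g p W V"
    and lin: "\<forall>V\<in>tangent_space X A p. \<forall>V'\<in>tangent_space X A p. \<forall>W\<in>tangent_space X A p. \<forall>a b.
           g p (\<lambda>u. a * V u + b * V' u) W = a * g p V W + b * g p V' W"
    and nondeg: "\<forall>V\<in>tangent_space X A p. (\<forall>W\<in>tangent_space X A p. g p V W = 0) \<longrightarrow> V = (\<lambda>_. 0)"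
    using metric top unfolding pseudo_riemannian_metric_def Let_def by blast+
  then show sym: "local_metric A g (U, \<phi>) x v w = local_metric A g (U, \<phi>) x w v" for v w
    using C by (simp add: p(2) local_metric_chart[OF chart p(1)])
  have add: "local_metric A g (U, \<phi>) x (a *\<^sub>R v + b *\<^sub>R v') w
      = a * local_metric A g (U, \<phi>) x v w + b * local_metric A g (U, \<phi>) x v' w" for a b v v' w
    using lin C by (simp add: p(2) local_metric_chart[OF chart p(1)] coordinate_vector_linear[OF chart p(1)])
  have l: "linear (\<lambda>v. local_metric A g (U, \<phi>) x v w)" for w
    by (rule linearI) (use add[of 1 _ 1] add[of _ _ 0] in auto)
  moreover have "local_metric A g (U, \<phi>) x w = (\<lambda>v. local_metric A g (U, \<phi>) x v w)" for w
    using sym by blast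
  ultimately show "bilinear (local_metric A g (U, \<phi>) x)"
    unfolding bilinear_def by metis
  assume "\<And>u. local_metric A g (U, \<phi>) x z u = 0"
  then have "?C z = (\<lambda>_. 0)"
    using nondeg C tangent_space_eq_coordinate_vectors[OF chart p(1)]
    by (auto simp: p(2) local_metric_chart[OF chart p(1)])
  then show "z = 0" by (rule coordinate_vector_eq_0D[OF chart p(1)])
qed

end

end

end

section \<open>Christoffel symbols and the second derivative in coordinates\<close>

lemma bilinear_euclidean_representation:
  fixes B :: "'e::euclidean_space \<Rightarrow> 'e \<Rightarrow> real"
  assumes "bilinear B"
  shows "B v w = (\<Sum>i\<in>Basis. \<Sum>j\<in>Basis. (v \<bullet> i) * (w \<bullet> j) * B i j)"
proof -
  have l: "linear (\<lambda>v. B v w)" "linear (B v)" for v w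
    using assms by (auto simp: bilinear_def)
  have "B v w = (\<Sum>i\<in>Basis. (v \<bullet> i) * B i w)"
    by (subst euclidean_representation[symmetric, of v])
      (simp add: linear_sum[OF l(1)] linear_scale[OF l(1)])
  also have "\<dots> = (\<Sum>i\<in>Basis. (v \<bullet> i) * (\<Sum>j\<in>Basis. (w \<bullet> j) * B i j))"
  proof (rule sum.cong[OF refl])
    fix i
    show "(v \<bullet> i) * B i w = (v \<bullet> i) * (\<Sum>j\<in>Basis. (w \<bullet> j) * B i j)"
      by (subst euclidean_representation[symmetric, of w])
        (simp add: linear_sum[OF l(2)] linear_scale[OF l(2)])
  qed
  finally show ?thesis by (simp add: sum_distrib_left mult.assoc)
qed

context
  fixes G :: "'e::euclidean_space \<Rightarrow> 'e \<Rightarrow> 'e \<Rightarrow> real" and S x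
  assumes open_S: "open S" and x: "x \<in> S"
    and bilinear_on: "\<forall>y\<in>S. bilinear (G y)"
    and diff: "\<And>v w. (\<lambda>y. G y v w) differentiable (at x)"
begin

private lemmas bil = bspec[OF bilinear_on]

text \<open>
  The derivative of the coefficients is again bilinear in \<open>v\<close> and \<open>w\<close>.
\<close>
lemma frechet_derivative_bilinear_family:
  "frechet_derivative (\<lambda>y. G y v w) (at x) d
    = (\<Sum>i\<in>Basis. \<Sum>j\<in>Basis. (v \<bullet> i) * (w \<bullet> j) * frechet_derivative (\<lambda>y. G y i j) (at x) d)"
proof -
  have "((\<lambda>y. \<Sum>i\<in>Basis. \<Sum>j\<in>Basis. (v \<bullet> i) * (w \<bullet> j) * G y i j) has_derivative
      (\<lambda>d. \<Sum>i\<in>Basis. \<Sum>j\<in>Basis. (v \<bullet> i) * (w \<bullet> j) * frechet_derivative (\<lambda>y. G y i j) (at x) d))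
      (at x)"
    by (intro has_derivative_sum has_derivative_mult_right diff[unfolded frechet_derivative_works])
  then have "((\<lambda>y. G y v w) has_derivative
      (\<lambda>d. \<Sum>i\<in>Basis. \<Sum>j\<in>Basis. (v \<bullet> i) * (w \<bullet> j) * frechet_derivative (\<lambda>y. G y i j) (at x) d))
      (at x)"
    by (rule has_derivative_transform_within_open[OF _ open_S x])
      (rule bilinear_euclidean_representation[OF bil, symmetric])
  from frechet_derivative_at[OF this] show ?thesis by (rule fun_cong[OF sym])
qed

text \<open>
  The product rule for \<open>G\<close> evaluated on moving vectors. Differentiability of \<open>G\<close> is given only for
  fixed arguments \<open>v\<close> and \<open>w\<close>, hence the detour through the coefficients of \<open>G\<close> in the standard basis.
\<close>
lemma has_real_derivative_bilinear_along_curve: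
  assumes ct: "c t = x"
    and c: "(c has_vector_derivative c') (at t)"
    and a: "(a has_vector_derivative a') (at t)"
    and b: "(b has_vector_derivative b') (at t)"
  shows "((\<lambda>s. G (c s) (a s) (b s)) has_real_derivative
    frechet_derivative (\<lambda>y. G y (a t) (b t)) (at x) c' + G x a' (b t) + G x (a t) b') (at t)"
proof -
  define D where "D i j = frechet_derivative (\<lambda>y. G y i j) (at x) c'" for i j
  have a1: "((\<lambda>s. a s \<bullet> i) has_real_derivative a' \<bullet> i) (at t)" for i
    unfolding has_field_derivative_def
    by (rule has_derivative_eq_rhs[OF has_derivative_inner_left[OF a[unfolded has_vector_derivative_def]]])
      (simp add: fun_eq_iff)
  have b1: "((\<lambda>s. b s \<bullet> i) has_real_derivative b' \<bullet> i) (at t)" for i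
    unfolding has_field_derivative_def
    by (rule has_derivative_eq_rhs[OF has_derivative_inner_left[OF b[unfolded has_vector_derivative_def]]])
      (simp add: fun_eq_iff)
  have G1: "((\<lambda>s. G (c s) i j) has_real_derivative D i j) (at t)" for i j
  proof -
    have g: "((\<lambda>y. G y i j) has_derivative frechet_derivative (\<lambda>y. G y i j) (at x)) (at (c t))"
      using diff[unfolded frechet_derivative_works] by (simp only: ct)
    show ?thesis
      unfolding has_field_derivative_def
      by (rule has_derivative_eq_rhs[OF has_derivative_compose[OF
              c[unfolded has_vector_derivative_def] g]])
        (simp add: fun_eq_iff D_def linear_scale[OF has_derivative_linear[OF g]])
  qed
  have "((\<lambda>s. \<Sum>i\<in>Basis. \<Sum>j\<in>Basis. (a s \<bullet> i) * (b s \<bullet> j) * G (c s) i j) has_real_derivative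
      (\<Sum>i\<in>Basis. \<Sum>j\<in>Basis. (a t \<bullet> i) * (b t \<bullet> j) * D i j + (a' \<bullet> i) * (b t \<bullet> j) * G x i j
        + (a t \<bullet> i) * (b' \<bullet> j) * G x i j)) (at t)"
  proof (intro DERIV_sum)
    fix i j
    show "((\<lambda>s. (a s \<bullet> i) * (b s \<bullet> j) * G (c s) i j) has_real_derivative
      (a t \<bullet> i) * (b t \<bullet> j) * D i j + (a' \<bullet> i) * (b t \<bullet> j) * G x i j
        + (a t \<bullet> i) * (b' \<bullet> j) * G x i j) (at t)"
      by (rule DERIV_cong[OF DERIV_mult[OF DERIV_mult[OF a1 b1] G1]]) (simp add: ct algebra_simps)
  qed
  then have "((\<lambda>s. \<Sum>i\<in>Basis. \<Sum>j\<in>Basis. (a s \<bullet> i) * (b s \<bullet> j) * G (c s) i j) has_real_derivative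
      frechet_derivative (\<lambda>y. G y (a t) (b t)) (at x) c' + G x a' (b t) + G x (a t) b') (at t)"
    unfolding frechet_derivative_bilinear_family[of "a t"]
      bilinear_euclidean_representation[OF bil[OF x], of a']
      bilinear_euclidean_representation[OF bil[OF x], of "a t"] D_def[symmetric]
    by (simp add: sum.distrib)
  moreover have "\<forall>\<^sub>F s in nhds t. (\<Sum>i\<in>Basis. \<Sum>j\<in>Basis. (a s \<bullet> i) * (b s \<bullet> j) * G (c s) i j)
      = G (c s) (a s) (b s)"
  proof -
    have "isCont c t" using c has_vector_derivative_continuous by blast
    then have "\<forall>\<^sub>F s in nhds t. c s \<in> S"
      using open_S x unfolding continuous_at_open eventually_nhds ct[symmetric] by metis
    then show ?thesis
      by eventually_elim (rule bilinear_euclidean_representation[OF bil, symmetric])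
  qed
  ultimately show ?thesis by (simp add: DERIV_cong_ev[OF refl _ refl])
qed

text \<open>
  The definite description in \<open>christoffel\<close> is met by exactly one vector: in finite dimension the
  injective map that lowers the index is also surjective, and the right-hand side is linear in \<open>u\<close>.
\<close>
lemma christoffel_lower:
  assumes nondeg: "\<And>z. (\<And>u. G x z u = 0) \<Longrightarrow> z = 0"
  shows "G x (christoffel G x v w) u =
     (frechet_derivative (\<lambda>y. G y w u) (at x) v
      + frechet_derivative (\<lambda>y. G y v u) (at x) w
      - frechet_derivative (\<lambda>y. G y v w) (at x) u) / 2"
proof -
  define L where "L u = (frechet_derivative (\<lambda>y. G y w u) (at x) v
      + frechet_derivative (\<lambda>y. G y v u) (at x) w
      - frechet_derivative (\<lambda>y. G y v w) (at x) u) / 2" for u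
  have lin: "linear (\<lambda>u. frechet_derivative (\<lambda>y. G y v u) (at x) d)" for v d
    unfolding frechet_derivative_bilinear_family[of v]
    by (intro bounded_linear.linear bounded_linear_sum bounded_linear_mult_const
        bounded_linear_const_mult bounded_linear_inner_left)
  have "linear (\<lambda>u. (1 / 2) *\<^sub>R (frechet_derivative (\<lambda>y. G y w u) (at x) v
      + frechet_derivative (\<lambda>y. G y v u) (at x) w
      - frechet_derivative (\<lambda>y. G y v w) (at x) u))"
    by (intro linear_compose_scale_right linear_compose_sub linear_compose_add lin
        linear_frechet_derivative diff)
  then have L: "linear L" by (simp add: L_def[abs_def])
  have bx: "linear (\<lambda>z. G x z u)" "linear (G x z)" for z u
    using bil[OF x] by (auto simp: bilinear_def)
  have ex: "\<exists>z. \<forall>u. G x z u = L u"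
  proof -
    \<comment> \<open>lowering the index, with covectors identified with vectors through the standard basis\<close>
    define T where "T z = (\<Sum>b\<in>Basis. G x z b *\<^sub>R b)" for z
    have T: "linear T" unfolding T_def
      by (rule linearI) (simp_all add: linear_add[OF bx(1)] linear_scale[OF bx(1)]
          scaleR_add_left sum.distrib scaleR_sum_right)
    have agree: "G x z u = L' u" if "linear L'" "\<And>b. b \<in> Basis \<Longrightarrow> G x z b = L' b" for z u L'
      by (rule fun_cong[OF linear_eq_stdbasis[OF bx(2) that]])
    have T_inner: "T z \<bullet> b = G x z b" if "b \<in> Basis" for z b
      unfolding T_def using that by simp
    have "z = 0" if "T z = 0" for z
    proof (rule nondeg)
      show "G x z u = 0" for u
        using agree[of "\<lambda>_. 0" z u] T_inner[of _ z] that by (simp add: linear_iff)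
    qed
    then have "inj T" by (simp add: linear_injective_0[OF T])
    then have "surj T" by (rule linear_inj_imp_surj[OF T])
    then obtain z where "T z = (\<Sum>b\<in>Basis. L b *\<^sub>R b)" by (metis surjD)
    then have "G x z b = L b" if "b \<in> Basis" for b
      using T_inner[OF that, of z] that by simp
    then have "G x z u = L u" for u using agree[OF L] by blast
    then show ?thesis by blast
  qed
  have uniq: "z = z'" if "\<forall>u. G x z u = L u" "\<forall>u. G x z' u = L u" for z z'
  proof -
    have "z - z' = 0"
      by (rule nondeg) (use that in \<open>simp add: linear_diff[OF bx(1)]\<close>)
    then show ?thesis by simp
  qed
  have "\<forall>u. G x (THE z. \<forall>u. G x z u = L u) u = L u"
    by (rule theI') (use ex uniq in blast)
  then show ?thesis by (simp add: christoffel_def L_def)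
qed

end

lemma has_vector_derivative_partial:
  fixes \<Psi> :: "real \<times> real \<Rightarrow> 'b::real_normed_vector"
  assumes "smooth_on N \<Psi>" and "(r, s) \<in> N"
  shows "((\<lambda>r. \<Psi> (r, s)) has_vector_derivative frechet_derivative \<Psi> (at (r, s)) (1, 0)) (at r)"
    and "((\<lambda>s. \<Psi> (r, s)) has_vector_derivative frechet_derivative \<Psi> (at (r, s)) (0, 1)) (at s)"
proof -
  note D = smooth_on_has_derivative[OF assms]
  have sc: "frechet_derivative \<Psi> (at (r, s)) (h, 0) = h *\<^sub>R frechet_derivative \<Psi> (at (r, s)) (1, 0)"
    "frechet_derivative \<Psi> (at (r, s)) (0, h) = h *\<^sub>R frechet_derivative \<Psi> (at (r, s)) (0, 1)" for h
    using linear_scale[OF has_derivative_linear[OF D], of h "(1, 0)"]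
      linear_scale[OF has_derivative_linear[OF D], of h "(0, 1)"] by auto
  have "((\<lambda>r. (r, s)) has_derivative (\<lambda>h. (h, 0))) (at r)"
    by (intro has_derivative_Pair has_derivative_ident has_derivative_const)
  from has_derivative_compose[OF this D]
  show "((\<lambda>r. \<Psi> (r, s)) has_vector_derivative frechet_derivative \<Psi> (at (r, s)) (1, 0)) (at r)"
    unfolding has_vector_derivative_def by (rule has_derivative_eq_rhs) (rule ext, rule sc(1))
  have "((\<lambda>s. (r, s)) has_derivative (\<lambda>h. (0, h))) (at s)"
    by (intro has_derivative_Pair has_derivative_ident has_derivative_const)
  from has_derivative_compose[OF this D]
  show "((\<lambda>s. \<Psi> (r, s)) has_vector_derivative frechet_derivative \<Psi> (at (r, s)) (0, 1)) (at s)"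
    unfolding has_vector_derivative_def by (rule has_derivative_eq_rhs) (rule ext, rule sc(2))
qed

lemma smooth_on_vector_derivative:
  fixes c :: "real \<Rightarrow> 'b::real_normed_vector"
  assumes "open J" and "smooth_on J c"
  shows "t \<in> J \<Longrightarrow> (c has_vector_derivative vector_derivative c (at t)) (at t)"
    and "smooth_on J (\<lambda>s. vector_derivative c (at s))"
proof -
  have diff: "c differentiable (at t)" if "t \<in> J" for t
    using smooth_on_has_derivative[OF assms(2) that] differentiableI by blast
  then show "t \<in> J \<Longrightarrow> (c has_vector_derivative vector_derivative c (at t)) (at t)"
    by (simp add: vector_derivative_works)
  show "smooth_on J (\<lambda>s. vector_derivative c (at s))"
    by (rule smooth_on_cong[OF assms(1) _ smooth_on_frechet_derivative[OF assms(2), of 1]])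
      (simp add: frechet_derivative_eq_vector_derivative[OF diff])
qed

text \<open>
  Here \<open>\<Psi>(r, s)\<close> stands for \<open>m\<^sub>r(\<gamma>(s))\<close> in coordinates, \<open>c\<close> for \<open>\<gamma>\<close>, and \<open>P s\<close> for the generator of the
  action at \<open>c s\<close>. With \<open>v = c'(t)\<close>, \<open>p = P t\<close> and \<open>Q\<close> the mixed second derivative of \<open>\<Psi>\<close>, there are three
  ingredients: the derivative of \<open>G(P, c')\<close> in \<open>s\<close>, namely \<open>D\<^sub>vG(p, v) + G(Q, v) + G(p, c'')\<close>; the
  derivative of the homogeneity of \<open>G\<close> in \<open>r\<close>, namely \<open>D\<^sub>pG(v, v) + 2 G(Q, v) = \<alpha> G(v, v)\<close>; and the
  geodesic equation for \<open>F\<^sup>\<beta> G\<close>, which expresses \<open>G(p, c'')\<close> through \<open>D\<^sub>vG(p, v)\<close>, \<open>D\<^sub>pG(v, v)\<close> and the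
  derivative of \<open>F\<^sup>\<beta>\<close>. In the sum all derivatives of \<open>G\<close> cancel.
\<close>
lemma second_derivative_along_conformal_geodesic:
  fixes G :: "'e::euclidean_space \<Rightarrow> 'e \<Rightarrow> 'e \<Rightarrow> real" and F :: "'e \<Rightarrow> real"
    and \<Psi> :: "real \<times> real \<Rightarrow> 'e" and \<alpha> \<beta> :: real
  defines "P \<equiv> \<lambda>s. frechet_derivative \<Psi> (at (1, s)) (1, 0)"
  assumes S: "open S" and bilinear_on: "\<forall>x\<in>S. bilinear (G x)"
    and sym: "\<And>x v w. x \<in> S \<Longrightarrow> G x v w = G x w v"
    and nondeg: "\<And>x z. x \<in> S \<Longrightarrow> (\<And>u. G x z u = 0) \<Longrightarrow> z = 0"
    and smoothG: "\<And>v w. smooth_on S (\<lambda>x. G x v w)"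
    and F: "smooth_on S F" "\<And>x. x \<in> S \<Longrightarrow> F x > 0"
    and J: "open J" "smooth_on J c" "\<And>s. s \<in> J \<Longrightarrow> c s \<in> S" "t \<in> J"
    and N: "open N" "smooth_on N \<Psi>" "\<And>s. s \<in> J \<Longrightarrow> (1, s) \<in> N"
    and start: "\<And>s. s \<in> J \<Longrightarrow> \<Psi> (1, s) = c s"
    and grad: "\<And>s w. s \<in> J \<Longrightarrow> G (c s) (P s) w = frechet_derivative F (at (c s)) w"
    and Euler: "frechet_derivative F (at (c t)) (P t) = \<alpha> * F (c t)"
    and homog: "\<And>r. (r, t) \<in> N \<Longrightarrow>
      G (\<Psi> (r, t)) (frechet_derivative \<Psi> (at (r, t)) (0, 1)) (frechet_derivative \<Psi> (at (r, t)) (0, 1))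
      = r powr \<alpha> * G (c t) (vector_derivative c (at t)) (vector_derivative c (at t))"
    and geod: "vector_derivative (\<lambda>s. vector_derivative c (at s)) (at t)
      + christoffel (\<lambda>x v w. F x powr \<beta> * G x v w) (c t)
          (vector_derivative c (at t)) (vector_derivative c (at t)) = 0"
  shows "((\<lambda>s. G (c s) (P s) (vector_derivative c (at s))) has_real_derivative
      \<alpha> / 2 * (1 + \<beta>) * G (c t) (vector_derivative c (at t)) (vector_derivative c (at t))
      - \<beta> * (G (c t) (P t) (vector_derivative c (at t)))\<^sup>2 / F (c t)) (at t)"
proof -
  define x where "x = c t"
  define c1 where "c1 = (\<lambda>s. vector_derivative c (at s))"
  define v where "v = c1 t"
  define c2 where "c2 = vector_derivative c1 (at t)"
  define p where "p = P t"
  define Q where "Q = frechet_derivative (\<lambda>z. frechet_derivative \<Psi> (at z) (1, 0)) (at (1, t)) (0, 1)"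
  define H where "H = (\<lambda>x v w. F x powr \<beta> * G x v w)"
  define D where "D v w = frechet_derivative (\<lambda>y. G y v w) (at x)" for v w
  define DF where "DF = frechet_derivative F (at x)"
  have x: "x \<in> S" using J by (simp add: x_def)
  have Fx: "F x > 0" using F(2)[OF x] .
  have diffG: "(\<lambda>y. G y v w) differentiable (at x)" for v w
    using smooth_on_has_derivative[OF smoothG x] differentiableI by blast
  note bil = bspec[OF bilinear_on]
  note along = has_real_derivative_bilinear_along_curve[OF S x bilinear_on diffG]
  have c1: "(c has_vector_derivative c1 s) (at s)" if "s \<in> J" for s
    unfolding c1_def by (rule smooth_on_vector_derivative(1)[OF J(1,2) that])
  have c2: "(c1 has_vector_derivative c2) (at t)"
    unfolding c2_def c1_def
    by (rule smooth_on_vector_derivative(1)[OF J(1) smooth_on_vector_derivative(2)[OF J(1,2)] J(4)])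
  have N1: "(1, t) \<in> N" by (rule N(3)[OF J(4)])
  have PQ: "(P has_vector_derivative Q) (at t)"
    unfolding P_def Q_def
    by (rule has_vector_derivative_partial(2)[OF smooth_on_frechet_derivative[OF N(2)] N1])
  have \<Psi>v: "frechet_derivative \<Psi> (at (1, t)) (0, 1) = v"
  proof (rule vector_derivative_unique_at)
    show "((\<lambda>s. \<Psi> (1, s)) has_vector_derivative frechet_derivative \<Psi> (at (1, t)) (0, 1)) (at t)"
      by (rule has_vector_derivative_partial(2)[OF N(2) N1])
    show "((\<lambda>s. \<Psi> (1, s)) has_vector_derivative v) (at t)"
      unfolding v_def
      by (rule has_vector_derivative_transform_within_open[OF c1[OF J(4)] J(1,4)])
        (simp add: start)
  qed
  have u': "((\<lambda>s. G (c s) (P s) (c1 s)) has_real_derivative D p v v + G x Q v + G x p c2) (at t)"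
    unfolding D_def p_def v_def
    by (rule along[OF x_def[symmetric] c1[OF J(4)] PQ c2])
  have lie: "D v v p + 2 * G x Q v = \<alpha> * G x v v"
  proof (rule DERIV_unique)
    \<comment> \<open>here the second derivatives of \<open>\<Psi>\<close> are interchanged: \<open>Q\<close> was defined as the \<open>s\<close>-derivative of \<open>P\<close>\<close>
    have "((\<lambda>r. frechet_derivative \<Psi> (at (r, t)) (0, 1)) has_vector_derivative Q) (at 1)"
      unfolding Q_def mixed_partial_derivatives_commute[OF N(1,2) N1, of "(1, 0)"]
      by (rule has_vector_derivative_partial(1)[OF smooth_on_frechet_derivative[OF N(2)] N1])
    from along[of "\<lambda>r. \<Psi> (r, t)" 1, OF _ has_vector_derivative_partial(1)[OF N(2) N1] this this]
    show "((\<lambda>r. G (\<Psi> (r, t)) (frechet_derivative \<Psi> (at (r, t)) (0, 1))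
        (frechet_derivative \<Psi> (at (r, t)) (0, 1))) has_real_derivative D v v p + 2 * G x Q v) (at 1)"
      using start[OF J(4)] sym[OF x] by (simp add: \<Psi>v D_def p_def P_def x_def add.commute)
    have "\<forall>\<^sub>F r in nhds 1. (r, t) \<in> N"
    proof -
      have "open ((\<lambda>r. (r, t)) -` N)"
        by (intro open_vimage N(1) continuous_intros)
      then show ?thesis using N1 eventually_nhds_in_open[of "(\<lambda>r. (r, t)) -` N" 1] by simp
    qed
    then have "\<forall>\<^sub>F r in nhds 1. r powr \<alpha> * G x v v = G (\<Psi> (r, t))
        (frechet_derivative \<Psi> (at (r, t)) (0, 1)) (frechet_derivative \<Psi> (at (r, t)) (0, 1))"
      by eventually_elim (simp add: homog x_def v_def c1_def)
    moreover have "((\<lambda>r. r powr \<alpha> * G x v v) has_real_derivative \<alpha> * G x v v) (at 1)"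
      by (auto intro!: derivative_eq_intros)
    ultimately show "((\<lambda>r. G (\<Psi> (r, t)) (frechet_derivative \<Psi> (at (r, t)) (0, 1))
        (frechet_derivative \<Psi> (at (r, t)) (0, 1))) has_real_derivative \<alpha> * G x v v) (at 1)"
      by (simp add: DERIV_cong_ev[OF refl _ refl])
  qed
  have DH: "((\<lambda>y. H y a b) has_derivative
      (\<lambda>d. F x powr \<beta> * D a b d + \<beta> * F x powr (\<beta> - 1) * DF d * G x a b)) (at x)" for a b
  proof -
    have f: "(F has_derivative DF) (at x)"
      unfolding DF_def by (rule smooth_on_has_derivative[OF F(1) x])
    have g: "((\<lambda>y. G y a b) has_derivative D a b) (at x)"
      unfolding D_def by (rule smooth_on_has_derivative[OF smoothG x])
    have "((\<lambda>y. F y powr \<beta>) has_derivative (\<lambda>d. \<beta> * F x powr (\<beta> - 1) * DF d)) (at x)"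
      using has_derivative_compose[OF f has_real_derivative_powr[OF Fx, of \<beta>, unfolded has_field_derivative_def]]
      by (simp add: mult.assoc)
    from has_derivative_mult[OF this g] show ?thesis
      unfolding H_def .
  qed
  have H: "H x (christoffel H x v v) p
    = (frechet_derivative (\<lambda>y. H y v p) (at x) v + frechet_derivative (\<lambda>y. H y v p) (at x) v
      - frechet_derivative (\<lambda>y. H y v v) (at x) p) / 2"
  proof (rule christoffel_lower[OF S x])
    show "\<forall>y\<in>S. bilinear (H y)"
    proof
      fix y assume y: "y \<in> S"
      have "linear (\<lambda>z. F y powr \<beta> * f z)" if "linear f" for f :: "'e \<Rightarrow> real"
        using linear_compose_scale_right[OF that, of "F y powr \<beta>"] by simp
      then show "bilinear (H y)" using bil[OF y] by (simp add: H_def bilinear_def)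
    qed
    show "(\<lambda>y. H y v w) differentiable (at x)" for v w
      by (rule differentiableI[OF DH])
    show "z = 0" if "\<And>u. H x z u = 0" for z
      by (rule nondeg[OF x]) (use that Fx in \<open>auto simp: H_def\<close>)
  qed
  have DFv: "DF a = G x p a" for a
    using grad[OF J(4)] by (simp add: x_def p_def DF_def)
  have DFp: "DF p = \<alpha> * F x" using Euler by (simp add: x_def p_def DF_def)
  define \<Gamma> where "\<Gamma> = christoffel H x v v"
  have Dsym: "D v p = D p v"
    unfolding D_def
    by (rule frechet_derivative_transform_within_open[OF diffG S x]) (simp add: sym)
  \<comment> \<open>the Christoffel symbol of \<open>F\<^sup>\<beta> G\<close> paired with the gradient, by Leibniz' rule\<close>
  have "F x powr \<beta> * G x \<Gamma> p
    = F x powr \<beta> * D v p v + \<beta> * F x powr (\<beta> - 1) * DF v * G x v p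
      - (F x powr \<beta> * D v v p + \<beta> * F x powr (\<beta> - 1) * DF p * G x v v) / 2"
    using H unfolding frechet_derivative_at[OF DH, symmetric] by (simp add: H_def \<Gamma>_def field_simps)
  also have "F x powr (\<beta> - 1) = F x powr \<beta> / F x"
    using Fx by (simp add: powr_diff)
  finally have "F x powr \<beta> * G x p \<Gamma> = F x powr \<beta> *
      (D p v v + \<beta> * (G x p v)\<^sup>2 / F x - (D v v p + \<alpha> * \<beta> * G x v v) / 2)"
    using Fx unfolding DFp DFv[of v] sym[OF x, of \<Gamma>] sym[OF x, of v p] Dsym
    by (simp add: field_simps power2_eq_square)
  then have "G x p \<Gamma> = D p v v + \<beta> * (G x p v)\<^sup>2 / F x - (D v v p + \<alpha> * \<beta> * G x v v) / 2"
    using Fx by simp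
  moreover have "c2 = - \<Gamma>"
    using geod unfolding c2_def c1_def \<Gamma>_def H_def x_def v_def by (simp add: eq_neg_iff_add_eq_0)
  moreover have "G x p (- \<Gamma>) = - G x p \<Gamma>"
    using bil[OF x] by (simp add: bilinear_def linear_neg)
  ultimately have "D p v v + G x Q v + G x p c2
      = \<alpha> / 2 * (1 + \<beta>) * G x v v - \<beta> * (G x p v)\<^sup>2 / F x"
    using lie by (simp add: field_simps)
  with u' show ?thesis
    unfolding x_def v_def p_def c1_def by simp
qed

section \<open>Homogeneous pairs\<close>

context manifold
begin

lemma smooth_function_along_curve:
  assumes "smooth_curve X A I \<gamma>" and "open I" and "smooth_function A u"
  shows "smooth_on I (\<lambda>s. u (\<gamma> s))"
proof (rule smooth_on_locally)
  fix s assume s: "s \<in> I"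
  have "continuous_map (top_of_set I) X \<gamma>" using assms(1) by (simp add: smooth_curve_def)
  then have "\<gamma> s \<in> topspace X" using s by (auto simp: continuous_map_def)
  then obtain U \<phi> where U: "(U, \<phi>) \<in> A" "\<gamma> s \<in> U" by (rule chart_exists)
  define J where "J = {s \<in> I. \<gamma> s \<in> U}"
  have J: "open J" "smooth_on J (\<lambda>s. \<phi> (\<gamma> s))"
    unfolding J_def by (rule smooth_curve_in_chart[OF assms(1,2) U(1)])+
  have "smooth_on (\<phi> ` U) (\<lambda>x. u (inv_into U \<phi> x))"
    using assms(3) U(1) unfolding smooth_function_def by fast
  from smooth_on_compose[OF J(1) chart_open_image[OF U(1)] _ J(2) this]
  have "smooth_on J (\<lambda>s. u (inv_into U \<phi> (\<phi> (\<gamma> s))))" by (auto simp: J_def)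
  then have "smooth_on J (\<lambda>s. u (\<gamma> s))"
    by (rule smooth_on_cong[OF J(1), rotated]) (simp add: J_def chart_inv[OF U(1)])
  then show "\<exists>T. open T \<and> s \<in> T \<and> smooth_on T (\<lambda>s. u (\<gamma> s))"
    using J(1) s U(2) by (intro exI[of _ J]) (simp add: J_def)
qed

lemma smooth_curve_shift:
  assumes "smooth_curve X A I \<gamma>" and "open I" and "(+) t ` K \<subseteq> I" and "open K"
  shows "smooth_curve X A K (\<lambda>s. \<gamma> (t + s))"
proof -
  have cont: "continuous_map (top_of_set I) X \<gamma>" using assms(1) by (simp add: smooth_curve_def)
  have shift: "continuous_map (top_of_set K) (top_of_set I) ((+) t)"
    using assms(3) by (auto intro!: continuous_intros)
  have cont': "continuous_map (top_of_set K) X (\<lambda>s. \<gamma> (t + s))"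
    using continuous_map_compose[OF shift cont] by (simp add: o_def)
  have "smooth_on {s \<in> K. \<gamma> (t + s) \<in> U} (\<lambda>s. \<phi> (\<gamma> (t + s)))" if U: "(U, \<phi>) \<in> A" for U \<phi>
  proof (rule smooth_on_compose[OF _ _ _ _ smooth_curve_in_chart(2)[OF assms(1,2) U]])
    show op: "open {s \<in> K. \<gamma> (t + s) \<in> U}"
      by (rule continuous_map_preimage_open[OF cont' assms(4) chart_open[OF U]])
    show "open {s \<in> I. \<gamma> s \<in> U}" by (rule smooth_curve_in_chart(1)[OF assms(1,2) U])
    show "(+) t ` {s \<in> K. \<gamma> (t + s) \<in> U} \<subseteq> {s \<in> I. \<gamma> s \<in> U}" using assms(3) by auto
    show "smooth_on {s \<in> K. \<gamma> (t + s) \<in> U} ((+) t)"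
      by (intro smooth_on_add smooth_on_const smooth_on_bounded_linear op bounded_linear_ident)
  qed
  then show ?thesis using cont' unfolding smooth_curve_def by blast
qed

lemma velocity_shift: "velocity A (\<lambda>s. \<gamma> (t + s)) 0 = velocity A \<gamma> t"
proof
  fix u
  have "deriv (\<lambda>s. u (\<gamma> (t + s))) 0 = deriv (\<lambda>s. u (\<gamma> s)) t"
    using DERIV_shift[of "\<lambda>s. u (\<gamma> s)" _ 0 t] unfolding deriv_def by (simp add: add.commute)
  then show "velocity A (\<lambda>s. \<gamma> (t + s)) 0 u = velocity A \<gamma> t u" by (simp add: velocity_def)
qed

lemma metric_zero:
  assumes "pseudo_riemannian_metric X A g" and "p \<in> topspace X"
  shows "g p (\<lambda>_. 0) (\<lambda>_. 0) = 0"
proof -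
  obtain U \<phi> where U: "(U, \<phi>) \<in> A" "p \<in> U" by (rule chart_exists[OF assms(2)])
  have 0: "coordinate_vector A (U, \<phi>) p 0 = (\<lambda>_. 0)"
    using coordinate_vector_linear[OF U, of 0 0 0 0] by simp
  have "local_metric A g (U, \<phi>) (\<phi> p) 0 0 = 0"
    using local_metric_bilinear[OF assms(1) U(1), of "\<phi> p"] U(2) by (simp add: bilinear_lzero)
  then show ?thesis by (simp add: local_metric_chart[OF U] 0)
qed

end

locale homogeneous_manifold = manifold X A
  for X :: "'m topology" and A :: "('m, 'e::euclidean_space) chart set" +
  fixes m :: "real \<Rightarrow> 'm \<Rightarrow> 'm" and \<alpha> :: real and g :: "'m metric_tensor" and f :: "'m \<Rightarrow> real"
  assumes action: "smooth_free_action X A m"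
    and homogeneous: "homogeneous_pair X A m \<alpha> g f"
    and degree_nonzero: "\<alpha> \<noteq> 0"
begin

lemma action_continuous: "continuous_map (prod_topology (top_of_set {0<..}) X) X (\<lambda>(r, x). m r x)"
  and action_one: "x \<in> topspace X \<Longrightarrow> m 1 x = x"
  using action unfolding smooth_free_action_def by (elim conjE, simp)+

lemma action_smooth:
  assumes U: "(U, \<phi>) \<in> A" and V: "(V, \<psi>) \<in> A"
  shows "smooth_on {(r, y). 0 < r \<and> y \<in> \<phi> ` U \<and> m r (inv_into U \<phi> y) \<in> V}
      (\<lambda>(r, y). \<psi> (m r (inv_into U \<phi> y)))"
proof -
  have "\<forall>(U, \<phi>)\<in>A. \<forall>(V, \<psi>)\<in>A.
        smooth_on {(r, y). 0 < r \<and> y \<in> \<phi> ` U \<and> m r (inv_into U \<phi> y) \<in> V}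
          (\<lambda>(r, y). \<psi> (m r (inv_into U \<phi> y)))"
    using action unfolding smooth_free_action_def by (elim conjE)
  from bspec[OF bspec[OF this U, unfolded prod.case] V] show ?thesis unfolding prod.case .
qed

lemma metric: "pseudo_riemannian_metric X A g"
  and f_smooth: "smooth_function A f"
  and f_pos: "x \<in> topspace X \<Longrightarrow> f x > 0"
  and f_homogeneous: "r > 0 \<Longrightarrow> x \<in> topspace X \<Longrightarrow> f (m r x) = r powr \<alpha> * f x"
  and g_homogeneous: "r > 0 \<Longrightarrow> x \<in> topspace X \<Longrightarrow> V \<in> tangent_space X A x \<Longrightarrow>
    W \<in> tangent_space X A x \<Longrightarrow> pullback A (m r) g x V W = r powr \<alpha> * g x V W"
  and gradient: "x \<in> topspace X \<Longrightarrow> V \<in> tangent_space X A x \<Longrightarrow>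
    g x (velocity A (\<lambda>t. m (exp t) x) 0) V = V f"
  using homogeneous unfolding homogeneous_pair_def by (elim conjE, simp)+

lemma continuous_map_action:
  assumes "continuous_map Y euclideanreal R" and "\<And>y. y \<in> topspace Y \<Longrightarrow> R y > 0"
    and "continuous_map Y X F"
  shows "continuous_map Y X (\<lambda>y. m (R y) (F y))"
proof -
  have "continuous_map Y (top_of_set {0<..}) R"
    using assms(1,2) by (auto simp: continuous_map_in_subtopology)
  then have "continuous_map Y (prod_topology (top_of_set {0<..}) X) (\<lambda>y. (R y, F y))"
    using assms(3) by (intro continuous_map_pairedI)
  from continuous_map_compose[OF this action_continuous] show ?thesis by (simp add: o_def)
qed

lemma action_domain_open:
  assumes U: "(U, \<phi>) \<in> A" and V: "openin X V"
  shows "open {(r, y). 0 < r \<and> y \<in> \<phi> ` U \<and> m r (inv_into U \<phi> y) \<in> V}"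
proof -
  let ?D = "{0::real<..} \<times> \<phi> ` U"
  have op: "open ?D" by (intro open_Times chart_open_image[OF U]) auto
  have "continuous_map (top_of_set ?D) (top_of_set (\<phi> ` U)) snd"
    by (auto intro!: continuous_intros)
  from continuous_map_compose[OF this chart_inv_continuous[OF U]]
  have "continuous_map (top_of_set ?D) X (\<lambda>z. m (fst z) (inv_into U \<phi> (snd z)))"
    by (intro continuous_map_action) (auto simp: o_def intro!: continuous_intros)
  from openin_continuous_map_preimage[OF this V]
  have "open {z \<in> ?D. m (fst z) (inv_into U \<phi> (snd z)) \<in> V}"
    using op openin_open_trans by (simp only: topspace_euclidean_subtopology)
  moreover have "{z \<in> ?D. m (fst z) (inv_into U \<phi> (snd z)) \<in> V}
      = {(r, y). 0 < r \<and> y \<in> \<phi> ` U \<and> m r (inv_into U \<phi> y) \<in> V}" by auto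
  ultimately show ?thesis by simp
qed

lemma smooth_on_action:
  assumes U: "(U, \<phi>) \<in> A" and V: "(V, \<psi>) \<in> A" and T: "open T"
    and R: "smooth_on T R" "\<And>z. z \<in> T \<Longrightarrow> R z > 0"
    and F: "smooth_on T (\<lambda>z. \<phi> (F z))" "\<And>z. z \<in> T \<Longrightarrow> F z \<in> U"
    and mV: "\<And>z. z \<in> T \<Longrightarrow> m (R z) (F z) \<in> V"
  shows "smooth_on T (\<lambda>z. \<psi> (m (R z) (F z)))"
proof -
  let ?W = "{(r, y). 0 < r \<and> y \<in> \<phi> ` U \<and> m r (inv_into U \<phi> y) \<in> V}"
  have "smooth_on T (\<lambda>z. (\<lambda>(r, y). \<psi> (m r (inv_into U \<phi> y))) (R z, \<phi> (F z)))"
  proof (rule smooth_on_compose[OF T action_domain_open[OF U chart_open[OF V]] _ _ action_smooth[OF U V]])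
    show "(\<lambda>z. (R z, \<phi> (F z))) ` T \<subseteq> ?W"
      using R(2) F(2) mV by (auto simp: chart_inv[OF U])
    show "smooth_on T (\<lambda>z. (R z, \<phi> (F z)))" by (intro smooth_on_Pair T R(1) F(1))
  qed
  then show ?thesis
    by (rule smooth_on_cong[OF T, rotated]) (simp add: chart_inv[OF U F(2)])
qed

lemma smooth_map_action:
  assumes "r > 0"
  shows "smooth_map X A (m r)"
proof -
  have cont: "continuous_map X X (m r)"
    using continuous_map_action[of X "\<lambda>_. r" "\<lambda>x. x"] assms by simp
  have "smooth_on {y \<in> \<phi> ` U. m r (inv_into U \<phi> y) \<in> V} (\<lambda>y. \<psi> (m r (inv_into U \<phi> y)))"
    if U: "(U, \<phi>) \<in> A" and V: "(V, \<psi>) \<in> A" for U \<phi> V \<psi>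
  proof (rule smooth_on_action[OF U V])
    let ?T = "{y \<in> \<phi> ` U. m r (inv_into U \<phi> y) \<in> V}"
    have "continuous_map (top_of_set (\<phi> ` U)) X (\<lambda>y. m r (inv_into U \<phi> y))"
      using continuous_map_compose[OF chart_inv_continuous[OF U] cont] by (simp add: o_def)
    from openin_continuous_map_preimage[OF this chart_open[OF V]]
    show T: "open ?T"
      using chart_open_image[OF U] openin_open_trans by (simp only: topspace_euclidean_subtopology)
    show "smooth_on ?T (\<lambda>_. r)" by (rule smooth_on_const[OF T])
    show "smooth_on ?T (\<lambda>y. \<phi> (inv_into U \<phi> y))"
      by (rule smooth_on_cong[OF T _ smooth_on_bounded_linear[OF T bounded_linear_ident]])
        (auto simp: chart_inv[OF U])
  qed (use assms in \<open>auto simp: chart_inv[OF U]\<close>)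
  then show ?thesis using cont unfolding smooth_map_def by blast
qed

lemma action_in_topspace: "r > 0 \<Longrightarrow> x \<in> topspace X \<Longrightarrow> m r x \<in> topspace X"
  using smooth_map_action[of r] by (auto simp: smooth_map_def continuous_map_def)

lemma smooth_curve_action:
  assumes \<gamma>: "smooth_curve X A I \<gamma>" and I: "open I"
    and R: "smooth_on I R" "\<And>s. s \<in> I \<Longrightarrow> R s > 0"
  shows "smooth_curve X A I (\<lambda>s. m (R s) (\<gamma> s))"
proof -
  have cont\<gamma>: "continuous_map (top_of_set I) X \<gamma>" using \<gamma> by (simp add: smooth_curve_def)
  have cont: "continuous_map (top_of_set I) X (\<lambda>s. m (R s) (\<gamma> s))"
    using smooth_on_imp_continuous_on[OF R(1)] R(2) cont\<gamma> by (intro continuous_map_action) auto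
  have "smooth_on {s \<in> I. m (R s) (\<gamma> s) \<in> V} (\<lambda>s. \<psi> (m (R s) (\<gamma> s)))" if V: "(V, \<psi>) \<in> A" for V \<psi>
  proof (rule smooth_on_locally)
    fix s assume s: "s \<in> {s \<in> I. m (R s) (\<gamma> s) \<in> V}"
    then have "\<gamma> s \<in> topspace X" using cont\<gamma> by (auto simp: continuous_map_def)
    then obtain U \<phi> where U: "(U, \<phi>) \<in> A" "\<gamma> s \<in> U" by (rule chart_exists)
    define T where "T = {s \<in> I. m (R s) (\<gamma> s) \<in> V} \<inter> {s \<in> I. \<gamma> s \<in> U}"
    have T: "open T" unfolding T_def
      by (intro open_Int continuous_map_preimage_open[OF cont I chart_open[OF V]]
          smooth_curve_in_chart(1)[OF \<gamma> I U(1)])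
    have "smooth_on T (\<lambda>s. \<psi> (m (R s) (\<gamma> s)))"
    proof (rule smooth_on_action[OF U(1) V T])
      show "smooth_on T R" by (rule smooth_on_subset[OF R(1)]) (auto simp: T_def)
      show "smooth_on T (\<lambda>s. \<phi> (\<gamma> s))"
        by (rule smooth_on_subset[OF smooth_curve_in_chart(2)[OF \<gamma> I U(1)]]) (auto simp: T_def)
    qed (use R(2) in \<open>auto simp: T_def\<close>)
    then show "\<exists>T. open T \<and> s \<in> T \<and> smooth_on T (\<lambda>s. \<psi> (m (R s) (\<gamma> s)))"
      using T s U(2) by (intro exI[of _ T]) (simp add: T_def)
  qed
  then show ?thesis using cont unfolding smooth_curve_def by blast
qed

end

text \<open>
  A curve together with a chart, which need not contain the whole curve. The set \<open>J\<close> collects the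
  parameters at which the curve, with coordinates \<open>c\<close>, lies in the chart; \<open>\<Psi>\<close> gives the coordinates of
  the translates of the curve and \<open>N\<close> is the open set of pairs \<open>(r, s)\<close> for which these make sense. The
  vector \<open>P s\<close> is the generator of the action at \<open>\<gamma> s\<close>.
\<close>
locale curve_in_chart = homogeneous_manifold X A m \<alpha> g f
  for X :: "'m topology" and A :: "('m, 'e::euclidean_space) chart set"
    and m :: "real \<Rightarrow> 'm \<Rightarrow> 'm" and \<alpha> :: real and g :: "'m metric_tensor" and f :: "'m \<Rightarrow> real" +
  fixes \<gamma> :: "real \<Rightarrow> 'm" and I :: "real set" and U :: "'m set" and \<phi> :: "'m \<Rightarrow> 'e"
  assumes curve: "smooth_curve X A I \<gamma>" and open_I: "open I" and chart: "(U, \<phi>) \<in> A"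
begin

definition J :: "real set" where "J = {s \<in> I. \<gamma> s \<in> U}"

definition c :: "real \<Rightarrow> 'e" where "c = (\<lambda>s. \<phi> (\<gamma> s))"

definition N :: "(real \<times> real) set" where "N = {(r, s). 0 < r \<and> s \<in> J \<and> m r (\<gamma> s) \<in> U}"

definition \<Psi> :: "real \<times> real \<Rightarrow> 'e" where "\<Psi> = (\<lambda>(r, s). \<phi> (m r (\<gamma> s)))"

definition P :: "real \<Rightarrow> 'e" where "P s = frechet_derivative \<Psi> (at (1, s)) (1, 0)"

abbreviation G :: "'e \<Rightarrow> 'e \<Rightarrow> 'e \<Rightarrow> real" where "G \<equiv> local_metric A g (U, \<phi>)"

abbreviation F :: "'e \<Rightarrow> real" where "F \<equiv> \<lambda>x. f (inv_into U \<phi> x)"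

lemma J_open: "open J" and c_smooth: "smooth_on J c"
  unfolding J_def c_def by (rule smooth_curve_in_chart[OF curve open_I chart])+

lemma curve_in_topspace: "s \<in> J \<Longrightarrow> \<gamma> s \<in> topspace X"
  using chart_subset[OF chart] by (auto simp: J_def)

lemma N_start: "s \<in> J \<Longrightarrow> (1, s) \<in> N" and \<Psi>_start: "s \<in> J \<Longrightarrow> \<Psi> (1, s) = c s"
  by (auto simp: N_def \<Psi>_def c_def action_one curve_in_topspace) (auto simp: J_def)

lemma c_in_chart: "s \<in> J \<Longrightarrow> c s \<in> \<phi> ` U"
  by (auto simp: c_def J_def)

lemma N_open: "open N"
proof -
  let ?D = "{0::real<..} \<times> J"
  have op: "open ?D" by (intro open_Times J_open) auto
  have cont: "continuous_map (top_of_set I) X \<gamma>" using curve by (simp add: smooth_curve_def)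
  have "continuous_map (top_of_set ?D) (top_of_set I) snd"
    by (auto intro!: continuous_intros simp: J_def)
  from continuous_map_compose[OF this cont]
  have "continuous_map (top_of_set ?D) X (\<lambda>z. \<gamma> (snd z))" by (simp add: o_def)
  then have "continuous_map (top_of_set ?D) X (\<lambda>z. m (fst z) (\<gamma> (snd z)))"
    by (intro continuous_map_action) (auto intro!: continuous_intros)
  from openin_continuous_map_preimage[OF this chart_open[OF chart]]
  have "open {z \<in> ?D. m (fst z) (\<gamma> (snd z)) \<in> U}"
    using op openin_open_trans by (simp only: topspace_euclidean_subtopology)
  moreover have "{z \<in> ?D. m (fst z) (\<gamma> (snd z)) \<in> U} = N" by (auto simp: N_def)
  ultimately show ?thesis by simp
qed

lemma \<Psi>_smooth: "smooth_on N \<Psi>"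
proof -
  have "smooth_on N (\<lambda>z. \<phi> (m (fst z) (\<gamma> (snd z))))"
  proof (rule smooth_on_action[OF chart chart N_open])
    show "smooth_on N fst" by (rule smooth_on_bounded_linear[OF N_open bounded_linear_fst])
    have "snd ` N \<subseteq> J" by (auto simp: N_def)
    then show "smooth_on N (\<lambda>z. \<phi> (\<gamma> (snd z)))"
      by (rule smooth_on_compose[OF N_open J_open _ _ c_smooth[unfolded c_def]])
        (rule smooth_on_bounded_linear[OF N_open bounded_linear_snd])
  qed (auto simp: N_def J_def)
  then show ?thesis by (simp add: \<Psi>_def case_prod_beta')
qed

lemma eventually_N:
  assumes "(r, s) \<in> N"
  shows "\<forall>\<^sub>F r' in nhds r. (r', s) \<in> N" and "\<forall>\<^sub>F s' in nhds s. (r, s') \<in> N"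
proof -
  have "open ((\<lambda>r. (r, s)) -` N)" "open ((\<lambda>s. (r, s)) -` N)"
    by (intro open_vimage N_open continuous_intros)+
  then show "\<forall>\<^sub>F r' in nhds r. (r', s) \<in> N" "\<forall>\<^sub>F s' in nhds s. (r, s') \<in> N"
    using assms eventually_nhds_in_open[of "(\<lambda>r. (r, s)) -` N" r]
      eventually_nhds_in_open[of "(\<lambda>s. (r, s)) -` N" s] by simp_all
qed

lemma velocity_orbit:
  assumes s: "s \<in> J"
  shows "velocity A (\<lambda>t. m (exp t) (\<gamma> s)) 0 = coordinate_vector A (U, \<phi>) (\<gamma> s) (P s)"
proof -
  have U: "m (exp 0) (\<gamma> s) \<in> U"
    using s by (simp add: action_one curve_in_topspace) (simp add: J_def)
  have exp: "(exp \<longlongrightarrow> 1) (nhds (0::real))"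
    using isCont_exp[of 0] unfolding continuous_at tendsto_at_iff_tendsto_nhds by simp
  have ev: "\<forall>\<^sub>F t in nhds 0. m (exp t) (\<gamma> s) \<in> U"
    using eventually_compose_filterlim[OF eventually_N(1)[OF N_start[OF s]] exp]
    by (rule eventually_mono) (simp add: N_def)
  have "((\<lambda>r. \<Psi> (r, s)) has_vector_derivative P s) (at (exp 0))"
    unfolding P_def using has_vector_derivative_partial(1)[OF \<Psi>_smooth N_start[OF s]] by simp
  \<comment> \<open>the generator is defined with \<open>m (exp t)\<close>, while \<open>P\<close> differentiates in \<open>r = exp t\<close>; both agree as \<open>exp' 0 = 1\<close>\<close>
  moreover have "(exp has_vector_derivative 1) (at (0::real))"
    using DERIV_exp[of "0::real"] by (simp add: has_real_derivative_iff_has_vector_derivative)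
  ultimately have "((\<lambda>t. \<Psi> (exp t, s)) has_vector_derivative P s) (at 0)"
    using vector_diff_chain_at[of exp 1 0 "\<lambda>r. \<Psi> (r, s)" "P s"] by (simp add: o_def)
  then have "((\<lambda>t. \<phi> (m (exp t) (\<gamma> s))) has_vector_derivative P s) (at 0)"
    by (simp add: \<Psi>_def)
  from velocity_eq_coordinate_vector[where \<gamma> = "\<lambda>t. m (exp t) (\<gamma> s)", OF chart U ev this]
  show ?thesis by (simp add: action_one curve_in_topspace[OF s])
qed

lemma velocity_action:
  assumes "(r, s) \<in> N"
  shows "velocity A (\<lambda>s. m r (\<gamma> s)) s
    = coordinate_vector A (U, \<phi>) (m r (\<gamma> s)) (frechet_derivative \<Psi> (at (r, s)) (0, 1))"
proof (rule velocity_eq_coordinate_vector[OF chart])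
  show "m r (\<gamma> s) \<in> U" using assms by (simp add: N_def)
  show "\<forall>\<^sub>F s in nhds s. m r (\<gamma> s) \<in> U"
    using eventually_N(2)[OF assms] by (rule eventually_mono) (simp add: N_def)
  show "((\<lambda>s. \<phi> (m r (\<gamma> s))) has_vector_derivative frechet_derivative \<Psi> (at (r, s)) (0, 1)) (at s)"
    using has_vector_derivative_partial(2)[OF \<Psi>_smooth assms] by (simp add: \<Psi>_def)
qed

lemma eventually_in_chart: "s \<in> J \<Longrightarrow> \<forall>\<^sub>F s' in nhds s. \<gamma> s' \<in> U"
  using eventually_nhds_in_open[OF J_open] by (rule eventually_mono) (auto simp: J_def)

lemma c_has_vector_derivative:
  "s \<in> J \<Longrightarrow> ((\<lambda>s. \<phi> (\<gamma> s)) has_vector_derivative vector_derivative c (at s)) (at s)"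
  using smooth_on_vector_derivative(1)[OF J_open c_smooth] by (simp add: c_def)

lemma velocity_curve:
  "s \<in> J \<Longrightarrow> velocity A \<gamma> s = coordinate_vector A (U, \<phi>) (\<gamma> s) (vector_derivative c (at s))"
  by (rule velocity_eq_coordinate_vector[OF chart _ eventually_in_chart c_has_vector_derivative])
    (simp_all add: J_def)

lemma coordinate_vector_f:
  assumes "s \<in> J"
  shows "coordinate_vector A (U, \<phi>) (\<gamma> s) w f = frechet_derivative F (at (c s)) w"
  using smooth_function_imp_smooth_near[OF f_smooth curve_in_topspace[OF assms]]
  by (simp add: coordinate_vector_def c_def)

lemma local_metric_curve:
  "s \<in> J \<Longrightarrow> G (c s) v w = g (\<gamma> s) (coordinate_vector A (U, \<phi>) (\<gamma> s) v)
    (coordinate_vector A (U, \<phi>) (\<gamma> s) w)"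
  unfolding c_def by (rule local_metric_chart[OF chart]) (simp add: J_def)

lemma coordinate_vector_tangent:
  "s \<in> J \<Longrightarrow> coordinate_vector A (U, \<phi>) (\<gamma> s) v \<in> tangent_space X A (\<gamma> s)"
  by (rule coordinate_vector_in_tangent_space[OF chart]) (simp add: J_def)

lemma local_gradient:
  assumes s: "s \<in> J"
  shows "G (c s) (P s) w = frechet_derivative F (at (c s)) w"
  using gradient[OF curve_in_topspace[OF s] coordinate_vector_tangent[OF s, of w]]
  by (simp add: local_metric_curve[OF s] velocity_orbit[OF s] coordinate_vector_f[OF s])

lemma local_Euler:
  assumes s: "s \<in> J"
  shows "frechet_derivative F (at (c s)) (P s) = \<alpha> * f (\<gamma> s)"
proof -
  have near: "smooth_near A (\<gamma> s) f"
    by (rule smooth_function_imp_smooth_near[OF f_smooth curve_in_topspace[OF s]])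
  have "frechet_derivative F (at (c s)) (P s) = velocity A (\<lambda>t. m (exp t) (\<gamma> s)) 0 f"
    by (simp add: velocity_orbit[OF s] coordinate_vector_f[OF s])
  also have "\<dots> = deriv (\<lambda>t. f (m (exp t) (\<gamma> s))) 0"
    using near by (simp add: velocity_def action_one curve_in_topspace[OF s])
  also have "(\<lambda>t. f (m (exp t) (\<gamma> s))) = (\<lambda>t. exp (\<alpha> * t) * f (\<gamma> s))"
    by (simp add: f_homogeneous curve_in_topspace[OF s] powr_def)
  also have "deriv \<dots> 0 = \<alpha> * f (\<gamma> s)"
    by (rule DERIV_imp_deriv) (auto intro!: derivative_eq_intros)
  finally show ?thesis .
qed

text \<open>
  The velocity of the translated curve is the pushforward of the velocity of the curve, so this is
  the homogeneity of \<open>g\<close> on the velocity of \<open>\<gamma>\<close>.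
\<close>
lemma local_homogeneity:
  assumes rs: "(r, s) \<in> N"
  shows "G (\<Psi> (r, s)) (frechet_derivative \<Psi> (at (r, s)) (0, 1)) (frechet_derivative \<Psi> (at (r, s)) (0, 1))
    = r powr \<alpha> * G (c s) (vector_derivative c (at s)) (vector_derivative c (at s))"
proof -
  have s: "s \<in> J" and r: "r > 0" and U: "m r (\<gamma> s) \<in> U" using rs by (auto simp: N_def)
  have T: "velocity A \<gamma> s \<in> tangent_space X A (\<gamma> s)"
    unfolding velocity_curve[OF s] by (rule coordinate_vector_tangent[OF s])
  have "G (\<Psi> (r, s)) (frechet_derivative \<Psi> (at (r, s)) (0, 1)) (frechet_derivative \<Psi> (at (r, s)) (0, 1))
      = g (m r (\<gamma> s)) (velocity A (\<lambda>s. m r (\<gamma> s)) s) (velocity A (\<lambda>s. m r (\<gamma> s)) s)"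
    unfolding velocity_action[OF rs] by (simp add: \<Psi>_def local_metric_chart[OF chart U])
  also have "\<dots> = pullback A (m r) g (\<gamma> s) (velocity A \<gamma> s) (velocity A \<gamma> s)"
    unfolding pullback_def
    by (simp add: pushforward_velocity[where \<gamma> = \<gamma> and t = s, OF smooth_map_action[OF r] curve_in_topspace[OF s]])
  also have "\<dots> = r powr \<alpha> * g (\<gamma> s) (velocity A \<gamma> s) (velocity A \<gamma> s)"
    by (rule g_homogeneous[OF r curve_in_topspace[OF s] T T])
  finally show ?thesis by (simp add: velocity_curve[OF s] local_metric_curve[OF s])
qed

lemma orbit_derivative_start:
  assumes s: "s \<in> J"
  shows "frechet_derivative \<Psi> (at (1, s)) (0, 1) = vector_derivative c (at s)"
proof (rule vector_derivative_unique_at)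
  show "((\<lambda>s. \<Psi> (1, s)) has_vector_derivative frechet_derivative \<Psi> (at (1, s)) (0, 1)) (at s)"
    by (rule has_vector_derivative_partial(2)[OF \<Psi>_smooth N_start[OF s]])
  show "((\<lambda>s. \<Psi> (1, s)) has_vector_derivative vector_derivative c (at s)) (at s)"
    by (rule has_vector_derivative_transform_within_open[OF
          smooth_on_vector_derivative(1)[OF J_open c_smooth s] J_open s]) (simp add: \<Psi>_start)
qed

text \<open>
  The derivative of \<open>f\<close> along the curve is written as \<open>g(P, \<gamma>')\<close>, the form that can be differentiated
  once more with the geodesic equation.
\<close>
lemma f_curve_has_derivative:
  assumes s: "s \<in> J"
  shows "((\<lambda>s. f (\<gamma> s)) has_real_derivative G (c s) (P s) (vector_derivative c (at s))) (at s)"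
proof -
  have "\<gamma> s \<in> U" using s by (simp add: J_def)
  from derivative_along_curve[OF chart this eventually_in_chart[OF s] c_has_vector_derivative[OF s]
      smooth_function_imp_smooth_near[OF f_smooth curve_in_topspace[OF s]]]
  show ?thesis by (simp add: local_gradient[OF s] coordinate_vector_f[OF s])
qed

lemma second_derivative_along_geodesic_in_chart:
  fixes \<beta> :: real
  assumes t: "t \<in> J"
    and geod: "vector_derivative (\<lambda>s. vector_derivative c (at s)) (at t)
      + christoffel (local_metric A (scale_tensor (\<lambda>x. f x powr \<beta>) g) (U, \<phi>)) (c t)
          (vector_derivative c (at t)) (vector_derivative c (at t)) = 0"
  shows "(deriv (\<lambda>s. f (\<gamma> s)) has_real_derivative
      \<alpha> / 2 * (1 + \<beta>) * g (\<gamma> t) (velocity A \<gamma> t) (velocity A \<gamma> t)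
      - \<beta> * (deriv (\<lambda>s. f (\<gamma> s)) t)\<^sup>2 / f (\<gamma> t)) (at t)"
proof -
  have pos: "F x > 0" if "x \<in> \<phi> ` U" for x
    using that f_pos chart_subset[OF chart] by (auto simp: chart_inv[OF chart])
  have h: "local_metric A (scale_tensor (\<lambda>x. f x powr \<beta>) g) (U, \<phi>) = (\<lambda>x v w. F x powr \<beta> * G x v w)"
    by (auto simp: fun_eq_iff local_metric_def scale_tensor_def Let_def)
  have smoothF: "smooth_on (\<phi> ` U) F"
    using f_smooth chart unfolding smooth_function_def by fast
  have Fc: "F (c s) = f (\<gamma> s)" if "s \<in> J" for s
    using that by (simp add: c_def J_def chart_inv[OF chart])
  have deriv: "deriv (\<lambda>s. f (\<gamma> s)) s = G (c s) (P s) (vector_derivative c (at s))" if "s \<in> J" for s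
    by (rule DERIV_imp_deriv[OF f_curve_has_derivative[OF that]])
  have "((\<lambda>s. G (c s) (P s) (vector_derivative c (at s))) has_real_derivative
      \<alpha> / 2 * (1 + \<beta>) * G (c t) (vector_derivative c (at t)) (vector_derivative c (at t))
      - \<beta> * (G (c t) (P t) (vector_derivative c (at t)))\<^sup>2 / F (c t)) (at t)"
    unfolding P_def
  proof (rule second_derivative_along_conformal_geodesic[OF chart_open_image[OF chart] _ _ _
        local_metric_smooth[OF metric chart] smoothF pos J_open c_smooth c_in_chart t
        N_open \<Psi>_smooth N_start \<Psi>_start])
    show "\<forall>x\<in>\<phi> ` U. bilinear (G x)"
      using local_metric_bilinear[OF metric chart] by blast
    show "G x v w = G x w v" if "x \<in> \<phi> ` U" for x v w
      by (rule local_metric_sym[OF metric chart that])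
    show "z = 0" if "x \<in> \<phi> ` U" "\<And>u. G x z u = 0" for x z
      by (rule local_metric_nondegenerate[OF metric chart that])
    show "G (c s) (frechet_derivative \<Psi> (at (1, s)) (1, 0)) w = frechet_derivative F (at (c s)) w"
      if "s \<in> J" for s w
      using local_gradient[OF that] by (simp add: P_def)
    show "frechet_derivative F (at (c t)) (frechet_derivative \<Psi> (at (1, t)) (1, 0)) = \<alpha> * F (c t)"
      using local_Euler[OF t] by (simp add: P_def Fc[OF t])
    show "G (\<Psi> (r, t)) (frechet_derivative \<Psi> (at (r, t)) (0, 1)) (frechet_derivative \<Psi> (at (r, t)) (0, 1))
      = r powr \<alpha> * G (c t) (vector_derivative c (at t)) (vector_derivative c (at t))"
      if "(r, t) \<in> N" for r
      by (rule local_homogeneity[OF that])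
    show "vector_derivative (\<lambda>s. vector_derivative c (at s)) (at t)
      + christoffel (\<lambda>x v w. F x powr \<beta> * G x v w) (c t)
          (vector_derivative c (at t)) (vector_derivative c (at t)) = 0"
      using geod unfolding h .
  qed
  also have "G (c t) (vector_derivative c (at t)) (vector_derivative c (at t))
      = g (\<gamma> t) (velocity A \<gamma> t) (velocity A \<gamma> t)"
    by (simp add: velocity_curve[OF t] local_metric_curve[OF t])
  finally have "((\<lambda>s. G (c s) (P s) (vector_derivative c (at s))) has_real_derivative
      \<alpha> / 2 * (1 + \<beta>) * g (\<gamma> t) (velocity A \<gamma> t) (velocity A \<gamma> t)
      - \<beta> * (deriv (\<lambda>s. f (\<gamma> s)) t)\<^sup>2 / f (\<gamma> t)) (at t)"
    by (simp only: deriv[OF t] Fc[OF t])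
  then show ?thesis
    by (rule has_field_derivative_transform_within_open[OF _ J_open t]) (simp add: deriv)
qed

end

section \<open>Convexity and the level sets\<close>

context homogeneous_manifold
begin

lemma curve_in_chart_exists:
  assumes "smooth_curve X A I \<gamma>" and "open I" and "t \<in> I"
  obtains U \<phi> where "curve_in_chart X A m \<alpha> g f \<gamma> I U \<phi>" and "(U, \<phi>) \<in> A" and "\<gamma> t \<in> U"
    and "t \<in> curve_in_chart.J \<gamma> I U"
proof -
  have "continuous_map (top_of_set I) X \<gamma>" using assms(1) by (simp add: smooth_curve_def)
  then have "\<gamma> t \<in> topspace X" using assms(3) by (auto simp: continuous_map_def)
  then obtain U \<phi> where U: "(U, \<phi>) \<in> A" "\<gamma> t \<in> U" by (rule chart_exists)
  then have *: "curve_in_chart X A m \<alpha> g f \<gamma> I U \<phi>"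
    using assms by unfold_locales
  show thesis
    by (rule that[OF * U]) (simp add: curve_in_chart.J_def[OF *] U assms)
qed

lemma second_derivative_along_geodesic:
  assumes geod: "geodesic X A (scale_tensor (\<lambda>x. f x powr \<beta>) g) I \<gamma>" and t: "t \<in> I"
  shows "((\<lambda>s. f (\<gamma> s)) has_real_derivative deriv (\<lambda>s. f (\<gamma> s)) t) (at t)"
    and "(deriv (\<lambda>s. f (\<gamma> s)) has_real_derivative
      \<alpha> / 2 * (1 + \<beta>) * g (\<gamma> t) (velocity A \<gamma> t) (velocity A \<gamma> t)
      - \<beta> * (deriv (\<lambda>s. f (\<gamma> s)) t)\<^sup>2 / f (\<gamma> t)) (at t)"
proof -
  have curve: "smooth_curve X A I \<gamma>" and I: "open I" using geod by (auto simp: geodesic_def)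
  obtain U \<phi> where U: "curve_in_chart X A m \<alpha> g f \<gamma> I U \<phi>" "(U, \<phi>) \<in> A" "\<gamma> t \<in> U"
    "t \<in> curve_in_chart.J \<gamma> I U"
    by (rule curve_in_chart_exists[OF curve I t])
  interpret curve_in_chart X A m \<alpha> g f \<gamma> I U \<phi> by (rule U(1))
  show "((\<lambda>s. f (\<gamma> s)) has_real_derivative deriv (\<lambda>s. f (\<gamma> s)) t) (at t)"
    using f_curve_has_derivative[OF U(4)] DERIV_imp_deriv by metis
  have "\<forall>(U, \<phi>)\<in>A. \<forall>t\<in>I. \<gamma> t \<in> U \<longrightarrow>
        (let c = (\<lambda>s. \<phi> (\<gamma> s)); c' = (\<lambda>s. vector_derivative c (at s)) in
           vector_derivative c' (at t)
           + christoffel (local_metric A (scale_tensor (\<lambda>x. f x powr \<beta>) g) (U, \<phi>)) (c t) (c' t) (c' t) = 0)"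
    using geod unfolding geodesic_def by (elim conjE)
  from bspec[OF bspec[OF this U(2), unfolded prod.case] t] U(3)
  show "(deriv (\<lambda>s. f (\<gamma> s)) has_real_derivative
      \<alpha> / 2 * (1 + \<beta>) * g (\<gamma> t) (velocity A \<gamma> t) (velocity A \<gamma> t)
      - \<beta> * (deriv (\<lambda>s. f (\<gamma> s)) t)\<^sup>2 / f (\<gamma> t)) (at t)"
    by (intro second_derivative_along_geodesic_in_chart[OF U(4)]) (simp add: Let_def c_def)
qed

text \<open>
  The curve \<open>\<delta>(s) = m(\<rho>(s))(\<gamma>(s))\<close> with \<open>\<rho>(s)\<^sup>\<alpha> = f(\<gamma>(0)) / f(\<gamma>(s))\<close> starts at \<open>\<gamma>(0)\<close> and stays in the level
  set of \<open>f\<close> through that point. Its velocity is \<open>\<gamma>'(0) + \<rho>'(0) P\<close> with \<open>\<rho>'(0) = - u' / (\<alpha> u)\<close>, the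
  component of \<open>\<gamma>'(0)\<close> orthogonal to \<open>P\<close>. The constant translation \<open>m r\<close> with \<open>r\<^sup>\<alpha> = l / f(\<gamma>(0))\<close> then moves
  \<open>\<delta>\<close> into the level set \<open>f = l\<close>.
\<close>
lemma level_set_tangent_vector_at_0:
  assumes curve: "smooth_curve X A {-e<..<e} \<gamma>" and e: "e > 0" and l: "l > 0"
  defines "S \<equiv> {x \<in> topspace X. f x = l}"
  shows "\<exists>q\<in>S. \<exists>V\<in>tangent_space_of X A S q.
    g q V V = l / f (\<gamma> 0) * (g (\<gamma> 0) (velocity A \<gamma> 0) (velocity A \<gamma> 0)
      - (deriv (\<lambda>s. f (\<gamma> s)) 0)\<^sup>2 / (\<alpha> * f (\<gamma> 0)))"
proof -
  let ?I = "{-e<..<e}"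
  have I: "open ?I" "0 \<in> ?I" using e by auto
  obtain U \<phi> where U: "curve_in_chart X A m \<alpha> g f \<gamma> ?I U \<phi>" "(U, \<phi>) \<in> A" "\<gamma> 0 \<in> U"
    "0 \<in> curve_in_chart.J \<gamma> ?I U"
    by (rule curve_in_chart_exists[OF curve I])
  interpret curve_in_chart X A m \<alpha> g f \<gamma> ?I U \<phi> by (rule U(1))
  note J0 = U(4)
  define u where "u = (\<lambda>s. f (\<gamma> s))"
  define u' where "u' = deriv u 0"
  define \<rho> where "\<rho> = (\<lambda>s. (u s * inverse (u 0)) powr (- (1 / \<alpha>)))"
  define r where "r = (l / u 0) powr (1 / \<alpha>)"
  define \<delta> where "\<delta> = (\<lambda>s. m (\<rho> s) (\<gamma> s))"
  define \<eta> where "\<eta> = (\<lambda>s. m r (\<delta> s))"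
  define a where "a = - u' / (\<alpha> * u 0)"
  define v where "v = vector_derivative c (at 0)"
  have "continuous_map (top_of_set ?I) X \<gamma>" using curve by (simp add: smooth_curve_def)
  then have top: "\<gamma> s \<in> topspace X" if "s \<in> ?I" for s using that by (auto simp: continuous_map_def)
  have u_pos: "u s > 0" if "s \<in> ?I" for s using f_pos[OF top[OF that]] by (simp add: u_def)
  note u0 = u_pos[OF I(2)]
  have \<rho>_pos: "\<rho> s > 0" if "s \<in> ?I" for s using u_pos[OF that] u0 by (simp add: \<rho>_def)
  have r_pos: "r > 0" using l u0 by (simp add: r_def)
  have \<rho>0: "\<rho> 0 = 1" using u0 by (simp add: \<rho>_def)
  have u_smooth: "smooth_on ?I u"
    unfolding u_def by (rule smooth_function_along_curve[OF curve I(1) f_smooth])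
  have \<rho>_smooth: "smooth_on ?I \<rho>" unfolding \<rho>_def
    by (rule smooth_on_compose[OF I(1) open_greaterThan _ _ smooth_on_powr])
      (use u_pos u0 in \<open>auto intro: smooth_on_bounded_linear_comp[OF I(1) bounded_linear_mult_left u_smooth]\<close>)
  have \<delta>_curve: "smooth_curve X A ?I \<delta>"
    unfolding \<delta>_def by (rule smooth_curve_action[OF curve I(1) \<rho>_smooth \<rho>_pos])
  have \<eta>_curve: "smooth_curve X A ?I \<eta>"
    unfolding \<eta>_def by (rule smooth_curve_action[OF \<delta>_curve I(1) smooth_on_const[OF I(1)] r_pos])
  have \<delta>_top: "\<delta> s \<in> topspace X" if "s \<in> ?I" for s
    unfolding \<delta>_def by (rule action_in_topspace[OF \<rho>_pos[OF that] top[OF that]])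
  have \<eta>_level: "\<eta> s \<in> S" if s: "s \<in> ?I" for s
  proof -
    have "\<rho> s powr \<alpha> = (u s * inverse (u 0)) powr (- 1)"
      using degree_nonzero by (simp add: \<rho>_def powr_powr)
    also have "\<dots> = u 0 / u s"
      using u_pos[OF s] u0 by (simp add: powr_minus divide_inverse)
    finally have "\<rho> s powr \<alpha> = u 0 / u s" .
    moreover have "r powr \<alpha> = l / u 0"
      using degree_nonzero l u0 by (simp add: r_def powr_powr)
    ultimately have "f (\<eta> s) = l / u 0 * (u 0 / u s * u s)"
      unfolding \<eta>_def f_homogeneous[OF r_pos \<delta>_top[OF s]]
      unfolding \<delta>_def f_homogeneous[OF \<rho>_pos[OF s] top[OF s]] by (simp add: u_def)
    also have "\<dots> = l" using u_pos[OF s] u0 by simp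
    finally show ?thesis
      using action_in_topspace[OF r_pos \<delta>_top[OF s]] by (simp add: S_def \<eta>_def)
  qed
  have V: "velocity A \<eta> 0 \<in> tangent_space_of X A S (\<eta> 0)"
    unfolding tangent_space_of_def using \<eta>_curve e \<eta>_level by blast
  have \<delta>0: "\<delta> 0 = \<gamma> 0" using action_one[OF top[OF I(2)]] by (simp add: \<delta>_def \<rho>0)
  have du: "(u has_real_derivative u') (at 0)"
    using f_curve_has_derivative[OF J0] DERIV_imp_deriv unfolding u_def u'_def by metis
  have d\<rho>: "(\<rho> has_real_derivative a) (at 0)"
  proof -
    have "((\<lambda>s. u s * inverse (u 0)) has_real_derivative u' * inverse (u 0)) (at 0)"
      by (rule DERIV_cmult_right[OF du])
    from DERIV_chain2[OF has_real_derivative_powr[of "u 0 * inverse (u 0)" "- (1 / \<alpha>)"] this]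
    show ?thesis using u0 by (simp add: \<rho>_def a_def divide_inverse mult_ac)
  qed
  have d\<delta>: "((\<lambda>s. \<phi> (\<delta> s)) has_vector_derivative a *\<^sub>R P 0 + v) (at 0)"
  proof -
    note D = smooth_on_has_derivative[OF \<Psi>_smooth N_start[OF J0]]
    have lin: "linear (frechet_derivative \<Psi> (at (1, 0)))" by (rule has_derivative_linear[OF D])
    have "frechet_derivative \<Psi> (at (1, 0)) (h * a, h) = h *\<^sub>R (a *\<^sub>R P 0 + v)" for h
    proof -
      have "(h * a, h) = h *\<^sub>R (a *\<^sub>R (1, 0) + (0, 1))" by simp
      then show ?thesis
        using orbit_derivative_start[OF J0]
        by (simp only: linear_scale[OF lin] linear_add[OF lin] P_def v_def)
    qed
    note dir = this
    have pair: "((\<lambda>s. (\<rho> s, s)) has_derivative (\<lambda>h. (h * a, h))) (at 0)"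
      using d\<rho> by (intro has_derivative_Pair has_derivative_ident)
        (simp add: has_field_derivative_def mult.commute[of _ a])
    have "((\<lambda>s. \<Psi> (\<rho> s, s)) has_derivative (\<lambda>h. h *\<^sub>R (a *\<^sub>R P 0 + v))) (at 0)"
      by (rule has_derivative_eq_rhs[OF has_derivative_compose[OF pair D[folded \<rho>0]]])
        (rule ext, simp only: \<rho>0 dir)
    then show ?thesis by (simp add: has_vector_derivative_def \<Psi>_def \<delta>_def)
  qed
  have "\<forall>\<^sub>F s in nhds 0. s \<in> {s \<in> ?I. \<delta> s \<in> U}"
    by (rule eventually_nhds_in_open[OF smooth_curve_in_chart(1)[OF \<delta>_curve I(1) U(2)]])
      (use I(2) U(3) in \<open>simp add: \<delta>0\<close>)
  then have "\<forall>\<^sub>F s in nhds 0. \<delta> s \<in> U" by (rule eventually_mono) simp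
  from velocity_eq_coordinate_vector[OF chart _ this d\<delta>]
  have vel\<delta>: "velocity A \<delta> 0 = coordinate_vector A (U, \<phi>) (\<gamma> 0) (a *\<^sub>R P 0 + v)"
    using U(3) by (simp add: \<delta>0)
  have T: "velocity A \<delta> 0 \<in> tangent_space X A (\<gamma> 0)"
    unfolding vel\<delta> by (rule coordinate_vector_tangent[OF J0])
  have bil: "bilinear (G (c 0))" by (rule local_metric_bilinear[OF metric chart c_in_chart[OF J0]])
  have Gpp: "G (c 0) (P 0) (P 0) = \<alpha> * u 0"
    using local_gradient[OF J0] local_Euler[OF J0] by (simp add: u_def)
  have Gpv: "G (c 0) (P 0) v = u'"
    using DERIV_unique[OF du] f_curve_has_derivative[OF J0] by (simp add: u_def v_def)
  have Gvp: "G (c 0) v (P 0) = u'"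
    using Gpv local_metric_sym[OF metric chart c_in_chart[OF J0]] by metis
  have Gvv: "G (c 0) v v = g (\<gamma> 0) (velocity A \<gamma> 0) (velocity A \<gamma> 0)"
    by (simp add: v_def velocity_curve[OF J0] local_metric_curve[OF J0])
  have "g (\<eta> 0) (velocity A \<eta> 0) (velocity A \<eta> 0)
      = pullback A (m r) g (\<gamma> 0) (velocity A \<delta> 0) (velocity A \<delta> 0)"
    unfolding pullback_def \<eta>_def
    using pushforward_velocity[where \<gamma> = \<delta> and t = 0, OF smooth_map_action[OF r_pos]]
      top[OF I(2)] by (simp add: \<delta>0)
  also have "\<dots> = r powr \<alpha> * g (\<gamma> 0) (velocity A \<delta> 0) (velocity A \<delta> 0)"
    by (rule g_homogeneous[OF r_pos top[OF I(2)] T T])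
  also have "r powr \<alpha> = l / u 0"
    using degree_nonzero l u0 by (simp add: r_def powr_powr)
  also have "g (\<gamma> 0) (velocity A \<delta> 0) (velocity A \<delta> 0) = G (c 0) (a *\<^sub>R P 0 + v) (a *\<^sub>R P 0 + v)"
    by (simp add: vel\<delta> local_metric_curve[OF J0])
  also have "\<dots> = a * a * (\<alpha> * u 0) + 2 * a * u' + G (c 0) v v"
    using bil by (simp add: bilinear_ladd bilinear_radd bilinear_lmul bilinear_rmul Gpp Gpv Gvp algebra_simps)
  also have "\<dots> = G (c 0) v v - u'\<^sup>2 / (\<alpha> * u 0)"
    using degree_nonzero u0 by (simp add: a_def field_simps power2_eq_square)
  finally show ?thesis
    using V \<eta>_level[OF I(2)] unfolding Gvv u'_def u_def by blast
qed

lemma level_set_tangent_vector: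
  assumes curve: "smooth_curve X A I \<gamma>" and I: "open I" "t \<in> I" and l: "l > 0"
  defines "S \<equiv> {x \<in> topspace X. f x = l}"
  obtains q V where "q \<in> S" "V \<in> tangent_space_of X A S q"
    "g q V V = l / f (\<gamma> t) * (g (\<gamma> t) (velocity A \<gamma> t) (velocity A \<gamma> t)
      - (deriv (\<lambda>s. f (\<gamma> s)) t)\<^sup>2 / (\<alpha> * f (\<gamma> t)))"
proof -
  obtain e where e: "e > 0" "ball t e \<subseteq> I" using openE[OF I] by blast
  have "(+) t ` {-e<..<e} \<subseteq> I"
    using e(2) by (auto simp: subset_iff dist_real_def)
  then have "smooth_curve X A {-e<..<e} (\<lambda>s. \<gamma> (t + s))"
    by (rule smooth_curve_shift[OF curve I(1)]) auto
  from level_set_tangent_vector_at_0[OF this e(1) l]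
  have "\<exists>q\<in>S. \<exists>V\<in>tangent_space_of X A S q.
    g q V V = l / f (\<gamma> t) * (g (\<gamma> t) (velocity A \<gamma> t) (velocity A \<gamma> t)
      - (deriv (\<lambda>s. f (\<gamma> (t + s))) 0)\<^sup>2 / (\<alpha> * f (\<gamma> t)))"
    unfolding S_def velocity_shift by simp
  moreover have "deriv (\<lambda>s. f (\<gamma> (t + s))) 0 = deriv (\<lambda>s. f (\<gamma> s)) t"
    using DERIV_shift[of "\<lambda>s. f (\<gamma> s)" _ 0 t] unfolding deriv_def by (simp add: add.commute)
  ultimately show thesis using that by metis
qed

text \<open>
  The two summands are the contributions of the components of the velocity tangent and transversal to
  the level sets. The tangent one is measured at a point of the chosen level set \<open>f = l\<close>, where its sign
  is known.
\<close>
lemma second_derivative_along_geodesic_split: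
  assumes geod: "geodesic X A (scale_tensor (\<lambda>x. f x powr \<beta>) g) I \<gamma>" and t: "t \<in> I" and l: "l > 0"
  defines "S \<equiv> {x \<in> topspace X. f x = l}"
  obtains q V where "q \<in> S" "V \<in> tangent_space_of X A S q"
    "(deriv (\<lambda>s. f (\<gamma> s)) has_real_derivative
      (1 + \<beta>) / 2 * (f (\<gamma> t) / l) * (\<alpha> * g q V V)
      + (1 - \<beta>) / 2 * ((deriv (\<lambda>s. f (\<gamma> s)) t)\<^sup>2 / f (\<gamma> t))) (at t)"
    "f (\<gamma> t) > 0"
proof -
  have curve: "smooth_curve X A I \<gamma>" and I: "open I" using geod by (auto simp: geodesic_def)
  obtain q V where q: "q \<in> S" "V \<in> tangent_space_of X A S q"
    and V: "g q V V = l / f (\<gamma> t) * (g (\<gamma> t) (velocity A \<gamma> t) (velocity A \<gamma> t)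
      - (deriv (\<lambda>s. f (\<gamma> s)) t)\<^sup>2 / (\<alpha> * f (\<gamma> t)))"
    unfolding S_def by (rule level_set_tangent_vector[OF curve I t l])
  have "continuous_map (top_of_set I) X \<gamma>" using curve by (simp add: smooth_curve_def)
  then have "\<gamma> t \<in> topspace X" using t by (auto simp: continuous_map_def)
  then have pos: "f (\<gamma> t) > 0" by (rule f_pos)
  have speed: "g (\<gamma> t) (velocity A \<gamma> t) (velocity A \<gamma> t)
      = f (\<gamma> t) / l * g q V V + (deriv (\<lambda>s. f (\<gamma> s)) t)\<^sup>2 / (\<alpha> * f (\<gamma> t))"
    unfolding V using pos l degree_nonzero by (simp add: field_simps)
  have "\<alpha> / 2 * (1 + \<beta>) * g (\<gamma> t) (velocity A \<gamma> t) (velocity A \<gamma> t)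
      - \<beta> * (deriv (\<lambda>s. f (\<gamma> s)) t)\<^sup>2 / f (\<gamma> t)
      = (1 + \<beta>) / 2 * (f (\<gamma> t) / l) * (\<alpha> * g q V V)
      + (1 - \<beta>) / 2 * ((deriv (\<lambda>s. f (\<gamma> s)) t)\<^sup>2 / f (\<gamma> t))"
    unfolding speed using pos l degree_nonzero by (simp add: field_simps)
  then show thesis
    using that[OF q _ pos] second_derivative_along_geodesic(2)[OF geod t] by simp
qed

text \<open>
  The tangent component may vanish, so definiteness gives a weak inequality only.
\<close>
lemma level_set_definite:
  assumes q: "q \<in> S" "V \<in> tangent_space_of X A S q" and S: "S \<subseteq> topspace X"
  shows "pullback_positive_definite X A S (scale_tensor (\<lambda>_. \<alpha>) g) \<Longrightarrow> \<alpha> * g q V V \<ge> 0"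
    and "pullback_negative_definite X A S (scale_tensor (\<lambda>_. \<alpha>) g) \<Longrightarrow> \<alpha> * g q V V \<le> 0"
proof -
  have zero: "g q V V = 0" if "V = (\<lambda>_. 0)"
    unfolding that using metric_zero[OF metric] q S by blast
  show "\<alpha> * g q V V \<ge> 0" if "pullback_positive_definite X A S (scale_tensor (\<lambda>_. \<alpha>) g)"
    using that q zero unfolding pullback_positive_definite_def scale_tensor_def
    by (cases "V = (\<lambda>_. 0)") (auto simp: less_imp_le)
  show "\<alpha> * g q V V \<le> 0" if "pullback_negative_definite X A S (scale_tensor (\<lambda>_. \<alpha>) g)"
    using that q zero unfolding pullback_negative_definite_def scale_tensor_def
    by (cases "V = (\<lambda>_. 0)") (auto simp: less_imp_le)
qed

end

theorem proposition3p22: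
  fixes X :: "'m topology"
    and A :: "('m, 'e::euclidean_space) chart set"
    and m :: "real \<Rightarrow> 'm \<Rightarrow> 'm"
    and g :: "'m metric_tensor"
    and f :: "'m \<Rightarrow> real"
    and \<alpha> \<beta> l :: real
  defines "M\<^sub>l \<equiv> {x \<in> topspace X. f x = l}"
    and "\<alpha>g \<equiv> scale_tensor (\<lambda>_. \<alpha>) g"
    and "h \<equiv> scale_tensor (\<lambda>x. f x powr \<beta>) g"
  assumes "smooth_manifold X A"
    and "smooth_free_action X A m"
    and "\<alpha> \<noteq> 0"
    and "homogeneous_pair X A m \<alpha> g f"
    and "l > 0"
  shows "(\<beta> = -1
          \<or> (-1 < \<beta> \<and> \<beta> \<le> 1 \<and> pullback_positive_definite X A M\<^sub>l \<alpha>g)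
          \<or> (\<beta> < -1 \<and> pullback_negative_definite X A M\<^sub>l \<alpha>g)
          \<longrightarrow> geodesically_convex X A h f)
       \<and> (\<beta> \<ge> 1 \<and> pullback_negative_definite X A M\<^sub>l \<alpha>g
          \<longrightarrow> geodesically_concave X A h f)"
proof -
  interpret homogeneous_manifold X A m \<alpha> g f
    by unfold_locales (fact assms)+
  have S: "M\<^sub>l \<subseteq> topspace X" by (auto simp: M\<^sub>l_def)
  have interval: "convex I" if "geodesic X A h I \<gamma>" for I \<gamma>
    using that by (simp add: geodesic_def is_interval_convex)
  have first: "((\<lambda>s. f (\<gamma> s)) has_real_derivative deriv (\<lambda>s. f (\<gamma> s)) t) (at t)"
    if "geodesic X A h I \<gamma>" "t \<in> I" for I \<gamma> t
    by (rule second_derivative_along_geodesic(1)[OF that[unfolded h_def]])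
  have second: "(deriv (\<lambda>s. f (\<gamma> s)) has_real_derivative deriv (deriv (\<lambda>s. f (\<gamma> s))) t) (at t)"
    if "geodesic X A h I \<gamma>" "t \<in> I" for I \<gamma> t
    using second_derivative_along_geodesic(2)[OF that[unfolded h_def]] DERIV_imp_deriv by metis
  show ?thesis
  proof (intro conjI impI)
    assume cases: "\<beta> = -1
          \<or> (-1 < \<beta> \<and> \<beta> \<le> 1 \<and> pullback_positive_definite X A M\<^sub>l \<alpha>g)
          \<or> (\<beta> < -1 \<and> pullback_negative_definite X A M\<^sub>l \<alpha>g)"
    have "deriv (deriv (\<lambda>s. f (\<gamma> s))) t \<ge> 0" if geod: "geodesic X A h I \<gamma>" and t: "t \<in> I" for I \<gamma> t
    proof -
      obtain q V where q: "q \<in> M\<^sub>l" "V \<in> tangent_space_of X A M\<^sub>l q"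
        and d: "(deriv (\<lambda>s. f (\<gamma> s)) has_real_derivative
          (1 + \<beta>) / 2 * (f (\<gamma> t) / l) * (\<alpha> * g q V V)
          + (1 - \<beta>) / 2 * ((deriv (\<lambda>s. f (\<gamma> s)) t)\<^sup>2 / f (\<gamma> t))) (at t)"
        and pos: "f (\<gamma> t) > 0"
        using second_derivative_along_geodesic_split[OF geod[unfolded h_def] t \<open>l > 0\<close>]
        unfolding M\<^sub>l_def by blast
      have "(1 + \<beta>) * (\<alpha> * g q V V) \<ge> 0"
        using cases level_set_definite[OF q S] unfolding \<alpha>g_def
        by (auto intro: mult_nonneg_nonneg mult_nonpos_nonpos)
      then have "f (\<gamma> t) / l / 2 * ((1 + \<beta>) * (\<alpha> * g q V V)) \<ge> 0"
        by (rule mult_nonneg_nonneg[rotated]) (use pos \<open>l > 0\<close> in simp)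
      then have "(1 + \<beta>) / 2 * (f (\<gamma> t) / l) * (\<alpha> * g q V V) \<ge> 0"
        by (simp add: mult_ac)
      moreover have "(1 - \<beta>) / 2 * ((deriv (\<lambda>s. f (\<gamma> s)) t)\<^sup>2 / f (\<gamma> t)) \<ge> 0"
        using cases pos by (intro mult_nonneg_nonneg) auto
      ultimately show ?thesis unfolding DERIV_imp_deriv[OF d] by simp
    qed
    then show "geodesically_convex X A h f"
      unfolding geodesically_convex_def
      by (intro allI impI f''_ge0_imp_convex[OF interval first second])
  next
    assume cases: "\<beta> \<ge> 1 \<and> pullback_negative_definite X A M\<^sub>l \<alpha>g"
    have "deriv (deriv (\<lambda>s. f (\<gamma> s))) t \<le> 0" if geod: "geodesic X A h I \<gamma>" and t: "t \<in> I" for I \<gamma> t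
    proof -
      obtain q V where q: "q \<in> M\<^sub>l" "V \<in> tangent_space_of X A M\<^sub>l q"
        and d: "(deriv (\<lambda>s. f (\<gamma> s)) has_real_derivative
          (1 + \<beta>) / 2 * (f (\<gamma> t) / l) * (\<alpha> * g q V V)
          + (1 - \<beta>) / 2 * ((deriv (\<lambda>s. f (\<gamma> s)) t)\<^sup>2 / f (\<gamma> t))) (at t)"
        and pos: "f (\<gamma> t) > 0"
        using second_derivative_along_geodesic_split[OF geod[unfolded h_def] t \<open>l > 0\<close>]
        unfolding M\<^sub>l_def by blast
      have "\<alpha> * g q V V \<le> 0"
        using cases level_set_definite(2)[OF q S] unfolding \<alpha>g_def by blast
      then have "(1 + \<beta>) / 2 * (f (\<gamma> t) / l) * (\<alpha> * g q V V) \<le> 0"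
        by (rule mult_nonneg_nonpos[rotated]) (use pos \<open>l > 0\<close> cases in simp)
      moreover have "(1 - \<beta>) / 2 * ((deriv (\<lambda>s. f (\<gamma> s)) t)\<^sup>2 / f (\<gamma> t)) \<le> 0"
        using cases pos by (intro mult_nonpos_nonneg) auto
      ultimately show ?thesis unfolding DERIV_imp_deriv[OF d] by simp
    qed
    then show "geodesically_concave X A h f"
      unfolding geodesically_concave_def
      by (intro allI impI f''_le0_imp_concave[OF interval first second])
  qed
qed

end
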